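(* Let $k\geq 4$ be an integer. For every $2$-contractible $k$-tree $\mathcal{H}$, \[\mathrm{forb}(n,\mathcal{H})= 2^{(\sigma(\mathcal{H}) - 1 +o(1))\binom{n}{k - 1}}\quad\text{as } n\to\infty.\]
   Context: A $k$-graph is a pair $(V,E)$ where $E$ is a family of $k$-subsets of $V$. For a $k$-graph $\mathcal{H}$, $\mathrm{forb}(n,\mathcal{H})$ is the number of labelled $k$-graphs on vertex set $[n]$ containing no copy of $\mathcal{H}$ as a subgraph. Hypertrees are defined recursively: a single edge is a hypertree; a hypergraph $\mathcal{H}$ with at least two edges is a hypertree if it has an edge $E$ such that $\mathcal{H}'=\mathcal{H}\setminus\{E\}$ is a hypertree and there is an edge $F$ of $\mathcal{H}'$ with $E\cap V(\mathcal{H}')=E\cap F$. A $k$-tree is a $k$-uniform hypertree. A $k$-graph is $2$-contractible if each of its edges contains at least $2$ vertices of degree $1$. A set $S\subseteq V(\mathcal{H})$ is a cross-cut of $\mathcal{H}$ if every edge of $\mathcal{H}$ meets $S$ in exactly one vertex; $\sigma(\mathcal{H})$ denotes the minimum size of a cross-cut of $\mathcal{H}$. *)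

theory Defs
  imports Complex_Main "HOL-Library.Ramsey"
begin

type_synonym 'a hypergraph = "'a set \<times> 'a set set"

abbreviation verts :: "'a hypergraph \<Rightarrow> 'a set" where
  "verts \<equiv> fst"

abbreviation edges :: "'a hypergraph \<Rightarrow> 'a set set" where
  "edges \<equiv> snd"

definition k_graph :: "nat \<Rightarrow> 'a hypergraph \<Rightarrow> bool" where
  "k_graph k H \<longleftrightarrow> edges H \<subseteq> nsets (verts H) k"

text \<open>The copy need not be induced.\<close>

definition contains_copy :: "'b hypergraph \<Rightarrow> 'a hypergraph \<Rightarrow> bool" where
  "contains_copy G H \<longleftrightarrow>
     (\<exists>f. inj_on f (verts H) \<and> f ` verts H \<subseteq> verts G \<and> (\<forall>e\<in>edges H. f ` e \<in> edges G))"

definition forb :: "nat \<Rightarrow> nat \<Rightarrow> 'a hypergraph \<Rightarrow> nat" where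
  "forb k n H =
     card {G :: nat hypergraph. verts G = {1..n} \<and> k_graph k G \<and> \<not> contains_copy G H}"

text \<open>The vertex set of a hypertree is the union of its edges: deleting the edge \<open>e\<close> also
  deletes the vertices that lie in no other edge.\<close>

inductive hypertree :: "'a hypergraph \<Rightarrow> bool" where
  single: "hypertree (e, {e})"
| add_edge: "hypertree (V, E) \<Longrightarrow> e \<notin> E \<Longrightarrow> f \<in> E \<Longrightarrow> e \<inter> V = e \<inter> f
    \<Longrightarrow> hypertree (V \<union> e, insert e E)"

definition k_tree :: "nat \<Rightarrow> 'a hypergraph \<Rightarrow> bool" where
  "k_tree k H \<longleftrightarrow> k_graph k H \<and> hypertree H"

definition degree :: "'a hypergraph \<Rightarrow> 'a \<Rightarrow> nat" where
  "degree H v = card {e \<in> edges H. v \<in> e}"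

definition two_contractible :: "'a hypergraph \<Rightarrow> bool" where
  "two_contractible H \<longleftrightarrow> (\<forall>e\<in>edges H. card {v \<in> e. degree H v = 1} \<ge> 2)"

definition cross_cut :: "'a hypergraph \<Rightarrow> 'a set \<Rightarrow> bool" where
  "cross_cut H S \<longleftrightarrow> S \<subseteq> verts H \<and> (\<forall>e\<in>edges H. card (e \<inter> S) = 1)"

definition cross_cut_number :: "'a hypergraph \<Rightarrow> nat" where
  "cross_cut_number H = (LEAST s. \<exists>S. cross_cut H S \<and> finite S \<and> card S = s)"

end

theory Submission imports Defs
begin

text \<open>
  Lower bound: fix a set \<open>T\<close> of \<open>\<sigma> - 1\<close> vertices; the trace on \<open>T\<close> of a copy of \<open>H\<close> in the family of
  \<open>k\<close>-sets meeting \<open>T\<close> exactly once would be a cross-cut of size less than \<open>\<sigma>\<close>.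

  Upper bound: encode an \<open>H\<close>-free edge set \<open>E\<close> on \<open>n\<close> vertices with \<open>o(n\<^sup>k\<^sup>-\<^sup>1)\<close> bits up to a family of
  about \<open>(\<sigma> - 1) (n choose (k - 1))\<close> possible edges.
  If every \<open>(k - 2)\<close>-set in the shadow were the kernel of a large sunflower, \<open>H\<close> could be embedded
  greedily, since by 2-contractibility edges of \<open>H\<close> meet in at most \<open>k - 2\<close> vertices. Peeling off the
  other \<open>(k - 2)\<close>-sets \<open>B\<close>, whose edges are hit by a bounded set \<open>Y B\<close>, confines \<open>E\<close> to
  \<open>O(n\<^sup>k\<^sup>-\<^sup>1)\<close> candidates that are determined by \<open>Y\<close>. Hence any \<open>\<delta> n\<^sup>k\<^sup>-\<^sup>1\<close> edges can be listed cheaply,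
  and so can the set \<open>P\<close> of \<open>(k - 1)\<close>-sets of degree at least \<open>a n\<close>, because \<open>P\<close> has \<open>O(n\<^sup>k\<^sup>-\<^sup>2)\<close> members.
  All but \<open>\<delta> n\<^sup>k\<^sup>-\<^sup>1\<close> edges consist of a centre \<open>x\<close> and a \<open>(k - 1)\<close>-set \<open>A\<close> such that \<open>P\<close> contains every
  \<open>(k - 1)\<close>-subset through \<open>x\<close>: among the remaining edges, two vertices could play the role of the
  degree-one vertices of \<open>H\<close> in a greedy embedding. Finally, if many \<open>A\<close> had \<open>\<sigma>\<close> centres, then many
  of them would share the same \<open>\<sigma>\<close> centres, and \<open>H\<close> could be embedded with a minimum cross-cut mapped
  onto these.
\<close>

subsection \<open>Peeling and greedy embeddings\<close>

text \<open>As soon as a class is bad it is deleted as a whole. It stays empty from then on, so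
  every key is charged at most once. The bound \<open>t\<close> is asked for all subsets
  \<open>S\<close> because deletions for other keys may already have thinned the class.\<close>

lemma peeling:
  fixes F :: "'a set" and K :: "'b set" and t :: "'b \<Rightarrow> real"
  assumes "finite F" "finite K"
    and bound: "\<And>\<kappa> S. \<kappa> \<in> K \<Longrightarrow> S \<subseteq> F \<inter> cls \<kappa> \<Longrightarrow> bad \<kappa> S \<Longrightarrow> real (card S) \<le> t \<kappa>"
    and nonneg: "\<And>\<kappa>. \<kappa> \<in> K \<Longrightarrow> 0 \<le> t \<kappa>"
  shows "\<exists>F'\<subseteq>F. real (card F) \<le> real (card F') + (\<Sum>\<kappa>\<in>K. t \<kappa>) \<and>
           (\<forall>\<kappa>\<in>K. F' \<inter> cls \<kappa> \<noteq> {} \<longrightarrow> \<not> bad \<kappa> (F' \<inter> cls \<kappa>))"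
  using assms
proof (induction "card K" arbitrary: F K)
  case 0
  then show ?case by auto
next
  case (Suc m)
  show ?case
  proof (cases "\<forall>\<kappa>\<in>K. F \<inter> cls \<kappa> \<noteq> {} \<longrightarrow> \<not> bad \<kappa> (F \<inter> cls \<kappa>)")
    case True
    then show ?thesis using Suc.prems(4) by (auto intro!: exI[of _ F] sum_nonneg)
  next
    case False
    then obtain \<kappa> where \<kappa>: "\<kappa> \<in> K" "bad \<kappa> (F \<inter> cls \<kappa>)" by auto
    have "\<exists>F'\<subseteq>F - cls \<kappa>. real (card (F - cls \<kappa>)) \<le> real (card F') + (\<Sum>\<kappa>\<in>K - {\<kappa>}. t \<kappa>) \<and>
           (\<forall>\<kappa>\<in>K - {\<kappa>}. F' \<inter> cls \<kappa> \<noteq> {} \<longrightarrow> \<not> bad \<kappa> (F' \<inter> cls \<kappa>))"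
    proof (rule Suc.hyps(1))
      show "real (card S) \<le> t \<mu>" if "\<mu> \<in> K - {\<kappa>}" "S \<subseteq> (F - cls \<kappa>) \<inter> cls \<mu>" "bad \<mu> S" for \<mu> S
        using that Suc.prems(3)[of \<mu> S] by blast
    qed (use Suc \<kappa> in auto)
    then obtain F' where F': "F' \<subseteq> F - cls \<kappa>"
      "real (card (F - cls \<kappa>)) \<le> real (card F') + (\<Sum>\<kappa>\<in>K - {\<kappa>}. t \<kappa>)"
      "\<forall>\<kappa>\<in>K - {\<kappa>}. F' \<inter> cls \<kappa> \<noteq> {} \<longrightarrow> \<not> bad \<kappa> (F' \<inter> cls \<kappa>)" by blast
    have "card F = card (F - cls \<kappa>) + card (F \<inter> cls \<kappa>)"
      using card_Int_Diff[OF Suc.prems(1), of "cls \<kappa>"] by simp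
    moreover have "real (card (F \<inter> cls \<kappa>)) \<le> t \<kappa>"
      by (rule Suc.prems(3)) (use \<kappa> in auto)
    moreover have "(\<Sum>\<kappa>\<in>K. t \<kappa>) = t \<kappa> + (\<Sum>\<kappa>\<in>K - {\<kappa>}. t \<kappa>)"
      using \<kappa> Suc.prems(2) by (simp add: sum.remove)
    ultimately have "real (card F) \<le> real (card F') + (\<Sum>\<kappa>\<in>K. t \<kappa>)"
      using F'(2) by linarith
    then show ?thesis using F' by blast
  qed
qed

lemma hypertree_verts: "hypertree H \<Longrightarrow> verts H = \<Union>(edges H) \<and> finite (edges H) \<and> edges H \<noteq> {}"
  by (induction rule: hypertree.induct) auto

text \<open>Used when an edge \<open>e\<close> is glued to an earlier edge along \<open>I\<close>:
  the shared vertices keep the positions they have there, and positions 0 and 1 go to vertices of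
  \<open>D\<close>, later the degree-one vertices.\<close>

lemma extend_enumeration:
  assumes "finite e" "card e = k" "I \<subseteq> e" "inj_on b I" "b ` I \<subseteq> {2..<k}" "2 \<le> card (e \<inter> D - I)"
  shows "\<exists>b'. bij_betw b' e {..<k} \<and> (\<forall>v\<in>I. b' v = b v) \<and> (\<forall>v\<in>e. b' v < 2 \<longrightarrow> v \<in> D)"
proof -
  obtain T where "T \<subseteq> e \<inter> D - I" "card T = 2" "finite T"
    using obtain_subset_with_card_n[OF assms(6)] by blast
  then obtain u w where uw: "u \<noteq> w" "u \<in> e" "u \<in> D" "u \<notin> I" "w \<in> e" "w \<in> D" "w \<notin> I"
    by (auto simp: card_2_iff)
  define R where "R = e - I - {u, w}"
  have fin: "finite I" "finite R" using assms finite_subset R_def by auto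
  have "card e = card (I \<union> R \<union> {u, w})"
    by (rule arg_cong[where f=card]) (use uw assms(3) R_def in auto)
  also have "\<dots> = card I + card R + 2"
    using fin uw R_def by (subst card_Un_disjoint; (subst card_Un_disjoint)?; auto)
  finally have card_k: "k = card I + card R + 2" using assms(2) by simp
  then have k2: "2 \<le> k" by simp
  have "card R = card ({2..<k} - b ` I)"
    using card_k assms fin by (simp add: card_Diff_subset card_image)
  then obtain g where g: "bij_betw g R ({2..<k} - b ` I)"
    using fin by (metis finite_Diff finite_atLeastLessThan finite_same_card_bij)
  define b' where "b' v = (if v \<in> I then b v else if v = u then 0 else if v = w then 1 else g v)" for v
  have "bij_betw b' I (b ` I)"
    using assms(4) by (auto simp: bij_betw_def b'_def inj_on_def)
  moreover have "bij_betw b' R ({2..<k} - b ` I)"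
    using g by (rule bij_betw_cong[THEN iffD1, rotated]) (auto simp: b'_def R_def)
  ultimately have 1: "bij_betw b' (I \<union> R) (b ` I \<union> ({2..<k} - b ` I))"
    by (rule bij_betw_combine) auto
  have 2: "bij_betw b' {u, w} {0, 1}"
    using uw by (auto simp: bij_betw_def b'_def)
  have "bij_betw b' ((I \<union> R) \<union> {u, w}) ((b ` I \<union> ({2..<k} - b ` I)) \<union> {0, 1})"
    by (rule bij_betw_combine[OF 1 2]) (use assms(5) in auto)
  moreover have "(I \<union> R) \<union> {u, w} = e" using uw assms(3) R_def by auto
  moreover have "(b ` I \<union> ({2..<k} - b ` I)) \<union> {0, 1} = {..<k}" using assms(5) k2 by auto
  ultimately have "bij_betw b' e {..<k}" by simp
  moreover have "v \<in> D" if "v \<in> e" "b' v < 2" for v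
  proof (rule ccontr)
    assume "v \<notin> D"
    then have "v \<in> I \<union> R" using that uw R_def by auto
    then have "b' v \<in> b ` I \<union> ({2..<k} - b ` I)" using bij_betw_apply[OF 1] by blast
    then have "b' v \<in> {2..<k}" using assms(5) by auto
    then show False using that by auto
  qed
  ultimately show ?thesis by (auto simp: b'_def intro!: exI[of _ b'])
qed

text \<open>An element of \<open>F\<close> is an edge with its vertices in a fixed order. Positions 0 and 1 are reserved
  for degree-one vertices of the tree, so that they may be changed together with any other position.\<close>

definition replaceable :: "nat \<Rightarrow> nat \<Rightarrow> (nat \<Rightarrow> 'b) set \<Rightarrow> bool" where
  "replaceable k M F \<longleftrightarrow> (\<forall>\<phi>\<in>F. \<forall>i<k. \<forall>W. finite W \<longrightarrow> card W \<le> M \<longrightarrow>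
     (\<exists>U. \<exists>\<psi>\<in>F. i \<in> U \<and> U \<subseteq> {0, 1, i} \<and> (\<forall>j\<in>{..<k} - U. \<psi> j = \<phi> j) \<and> (\<forall>j\<in>U. \<psi> j \<notin> W)))"

text \<open>The positions of \<open>K\<close> are treated one at a time. A replacement for
  \<open>i\<close> touches only positions among 0, 1 and \<open>i\<close>, all in \<open>K\<close>,
  and every touched position ends outside \<open>W\<close>; so the positions treated before stay
  outside \<open>W\<close>.\<close>

lemma replaceable_many:
  assumes F: "replaceable k M F" "\<phi> \<in> F" and K: "K \<subseteq> {..<k}" "{0, 1} \<subseteq> K"
    and W: "finite W" "card W \<le> M"
  shows "\<exists>\<psi>\<in>F. (\<forall>j\<in>{..<k} - K. \<psi> j = \<phi> j) \<and> (\<forall>j\<in>K. \<psi> j \<notin> W)"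
proof -
  have "\<exists>\<psi>\<in>F. (\<forall>j\<in>{..<k} - K. \<psi> j = \<phi> j) \<and> (\<forall>j\<in>J. \<psi> j \<notin> W)" if "finite J" "J \<subseteq> K" for J
    using that
  proof (induction J rule: finite_induct)
    case empty
    then show ?case using F by auto
  next
    case (insert i J)
    then obtain \<psi> where \<psi>: "\<psi> \<in> F" "\<forall>j\<in>{..<k} - K. \<psi> j = \<phi> j" "\<forall>j\<in>J. \<psi> j \<notin> W" by auto
    have "i < k" using insert.prems K by auto
    then obtain U \<psi>' where U: "\<psi>' \<in> F" "i \<in> U" "U \<subseteq> {0, 1, i}"
      "\<forall>j\<in>{..<k} - U. \<psi>' j = \<psi> j" "\<forall>j\<in>U. \<psi>' j \<notin> W"
      using F(1)[unfolded replaceable_def, rule_format, OF \<psi>(1) _ W] by blast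
    have UK: "U \<subseteq> K" using U insert.prems K by auto
    have "\<psi>' j \<notin> W" if "j \<in> insert i J" for j
    proof (cases "j \<in> U")
      case False
      then have "\<psi>' j = \<psi> j" "j \<in> J" using U that insert.prems K by auto
      then show ?thesis using \<psi> by auto
    qed (use U in auto)
    moreover have "\<psi>' j = \<phi> j" if "j \<in> {..<k} - K" for j
      using that U(4) \<psi>(2) UK by (metis Diff_iff subsetD)
    ultimately show ?case using U(1) by blast
  qed
  from this[of K] K show ?thesis using finite_subset[OF K(1)] by auto
qed

text \<open>Greedy embedding along the recursive construction. Every embedded edge remembers an
  ordering in \<open>F\<close> and a numbering that gives positions 0 and 1 to vertices of
  \<open>D\<close>. A new edge meets the earlier vertices inside one old edge \<open>f\<close> and
  away from \<open>D\<close>, so all positions of the ordering of \<open>f\<close> outside the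
  intersection, among them 0 and 1, can be given fresh vertices.\<close>

lemma embed_replaceable:
  assumes "hypertree H" "\<And>e. e \<in> edges H \<Longrightarrow> finite e \<and> card e = k"
    and "\<And>e. e \<in> edges H \<Longrightarrow> 2 \<le> card (e \<inter> D)"
    and "\<And>e e'. e \<in> edges H \<Longrightarrow> e' \<in> edges H \<Longrightarrow> e \<noteq> e' \<Longrightarrow> e \<inter> e' \<inter> D = {}"
    and "card (verts H) \<le> M"
    and F: "replaceable k M F" "F \<noteq> {}" "\<And>\<phi>. \<phi> \<in> F \<Longrightarrow> inj_on \<phi> {..<k}"
  shows "\<exists>f. inj_on f (verts H) \<and> (\<forall>e\<in>edges H. \<exists>\<phi>\<in>F. \<exists>b. bij_betw b e {..<k} \<and>
           (\<forall>v\<in>e. f v = \<phi> (b v)) \<and> (\<forall>v\<in>e. b v < 2 \<longrightarrow> v \<in> D))"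
  using assms(1-5)
proof (induction rule: hypertree.induct)
  case (single e)
  then have e: "finite e" "card e = k" "2 \<le> card (e \<inter> D)" by auto
  from extend_enumeration[of e k "{}" undefined D] e obtain b where
    b: "bij_betw b e {..<k}" "\<forall>v\<in>e. b v < 2 \<longrightarrow> v \<in> D" by auto
  obtain \<phi> where \<phi>: "\<phi> \<in> F" using F by auto
  have "inj_on (\<phi> \<circ> b) e" using b F(3)[OF \<phi>] by (auto simp: bij_betw_def intro: comp_inj_on)
  moreover have "\<forall>v\<in>e. (\<phi> \<circ> b) v = \<phi> (b v)" by simp
  ultimately show ?case using b \<phi> by (auto simp del: o_apply)
next
  case (add_edge V E e f)
  have VE: "V = \<Union>E" "finite E" using hypertree_verts[OF add_edge.hyps(1)] by auto
  have finV: "finite V" using VE add_edge.prems(1) by auto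
  have e: "finite e" "card e = k" "2 \<le> card (e \<inter> D)" using add_edge.prems by auto
  have cV: "card V \<le> M"
    using card_mono[of "V \<union> e" V] finV e add_edge.prems(4) by auto
  have "\<exists>f. inj_on f (verts (V, E)) \<and> (\<forall>e\<in>edges (V, E). \<exists>\<phi>\<in>F. \<exists>b. bij_betw b e {..<k} \<and>
           (\<forall>v\<in>e. f v = \<phi> (b v)) \<and> (\<forall>v\<in>e. b v < 2 \<longrightarrow> v \<in> D))"
    by (rule add_edge.IH) (use add_edge.prems cV in auto)
  then obtain g where g: "inj_on g V" "\<forall>e\<in>E. \<exists>\<phi>\<in>F. \<exists>b. bij_betw b e {..<k} \<and>
           (\<forall>v\<in>e. g v = \<phi> (b v)) \<and> (\<forall>v\<in>e. b v < 2 \<longrightarrow> v \<in> D)" by auto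
  then obtain \<phi> b where \<phi>: "\<phi> \<in> F" and b: "bij_betw b f {..<k}" "\<forall>v\<in>f. g v = \<phi> (b v)"
    "\<forall>v\<in>f. b v < 2 \<longrightarrow> v \<in> D" using add_edge.hyps(3) by blast
  define I where "I = e \<inter> f"
  have "e \<noteq> f" using add_edge by auto
  then have ID: "I \<inter> D = {}" using add_edge.prems(3)[of e f] add_edge.hyps(3) I_def by auto
  have b2: "b ` I \<subseteq> {2..<k}"
    using b ID by (force simp: I_def bij_betw_def)
  have binj: "inj_on b I" using b by (auto simp: bij_betw_def I_def intro: inj_on_subset)
  have "e \<inter> D - I = e \<inter> D" using ID by auto
  then obtain b' where b': "bij_betw b' e {..<k}" "\<forall>v\<in>I. b' v = b v" "\<forall>v\<in>e. b' v < 2 \<longrightarrow> v \<in> D"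
    using extend_enumeration[of e k I b D] e b2 binj by (auto simp: I_def)
  have "card (e \<inter> D) \<le> k" using e card_mono[of e "e \<inter> D"] by auto
  then have k2: "2 \<le> k" using e by simp
  \<comment> \<open>The ordering of \<open>f\<close> is kept on the positions of \<open>I\<close>
    and moved off the current image everywhere else; the result \<open>\<psi>\<close> becomes the
    ordering of \<open>e\<close>.\<close>
  have "card (g ` V) \<le> M" using cV card_image_le[OF finV, of g] by simp
  then obtain \<psi> where \<psi>: "\<psi> \<in> F" "\<forall>j\<in>{..<k} - ({..<k} - b ` I). \<psi> j = \<phi> j"
    "\<forall>j\<in>{..<k} - b ` I. \<psi> j \<notin> g ` V"
    using replaceable_many[OF F(1) \<phi>, of "{..<k} - b ` I" "g ` V"] b2 finV k2 by force
  define h where "h v = (if v \<in> V then g v else \<psi> (b' v))" for v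
  have eV: "v \<in> V \<longleftrightarrow> v \<in> I" if "v \<in> e" for v using add_edge.hyps(4) that by (auto simp: I_def)
  have h_e: "h v = \<psi> (b' v)" if "v \<in> e" for v
  proof (cases "v \<in> V")
    case True
    then have v: "v \<in> I" using eV that by simp
    have "b v \<in> {..<k} - ({..<k} - b ` I)" using v b2 by auto
    then have "\<psi> (b v) = \<phi> (b v)" using \<psi>(2) by blast
    moreover have "b' v = b v" using b'(2) v by blast
    moreover have "g v = \<phi> (b v)" using b(2) v by (auto simp: I_def)
    ultimately show ?thesis using True by (simp add: h_def)
  qed (simp add: h_def)
  have inje: "inj_on h e"
  proof -
    have "inj_on (\<psi> \<circ> b') e" using b' F(3)[OF \<psi>(1)] by (auto simp: bij_betw_def intro: comp_inj_on)
    then show ?thesis using h_e by (auto simp: inj_on_def)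
  qed
  have new: "h v \<notin> g ` V" if "v \<in> e" "v \<notin> V" for v
  proof -
    have "b' v \<notin> b ` I"
    proof
      assume "b' v \<in> b ` I"
      then obtain u where "u \<in> I" "b' v = b' u" using b'(2) by auto
      then have "v = u" using b'(1) that by (auto simp: bij_betw_def inj_on_def I_def)
      then show False using \<open>u \<in> I\<close> eV that by auto
    qed
    moreover have "b' v < k" using b'(1) that by (auto simp: bij_betw_def)
    ultimately show ?thesis using \<psi>(3) h_e that by auto
  qed
  have hV: "h v = g v" if "v \<in> V" for v using that by (simp add: h_def)
  have injh: "inj_on h (V \<union> e)"
  proof (rule inj_onI)
    fix x y assume xy: "x \<in> V \<union> e" "y \<in> V \<union> e" "h x = h y"
    show "x = y"
    proof (cases "x \<in> V"; cases "y \<in> V")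
      assume "x \<in> V" "y \<in> V" then show ?thesis using xy g(1) hV by (auto simp: inj_on_def)
    next
      assume "x \<in> V" "y \<notin> V" then show ?thesis using xy new[of y] hV by (metis Un_iff image_eqI)
    next
      assume "x \<notin> V" "y \<in> V" then show ?thesis using xy new[of x] hV by (metis Un_iff image_eqI)
    next
      assume "x \<notin> V" "y \<notin> V" then show ?thesis using xy inje by (auto simp: inj_on_def)
    qed
  qed
  have "\<exists>\<phi>\<in>F. \<exists>b. bij_betw b e' {..<k} \<and> (\<forall>v\<in>e'. h v = \<phi> (b v)) \<and> (\<forall>v\<in>e'. b v < 2 \<longrightarrow> v \<in> D)"
    if "e' \<in> insert e E" for e'
  proof (cases "e' = e")
    case True
    then show ?thesis using b' h_e \<psi>(1) by auto
  next
    case False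
    then have "e' \<in> E" "e' \<subseteq> V" using that VE by auto
    then show ?thesis using g(2) hV by (metis subsetD)
  qed
  then show ?case using injh by (auto intro!: exI[of _ h])
qed

lemma card_nsets_le_power: "finite V \<Longrightarrow> card (nsets V m) \<le> card V ^ m"
  by (cases "m \<le> card V") (auto simp: card_nsets binomial_le_pow binomial_eq_0)

lemma contains_copy_mono: "contains_copy (V, E) H \<Longrightarrow> E \<subseteq> E' \<Longrightarrow> contains_copy (V, E') H"
  unfolding contains_copy_def by (simp, meson subsetD)

lemma contains_copyI:
  assumes "inj_on f (verts H)" "verts H = \<Union>(edges H)" "E \<subseteq> nsets V k" "\<And>e. e \<in> edges H \<Longrightarrow> f ` e \<in> E"
  shows "contains_copy (V, E) H"
proof -
  have "f v \<in> V" if "e \<in> edges H" "v \<in> e" for e v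
    using assms(3) assms(4)[OF that(1)] that(2) by (auto simp: nsets_def)
  then show ?thesis using assms by (auto simp: contains_copy_def)
qed

section \<open>Embedding with the cross-cut placed in advance\<close>

text \<open>The edge consists of its cross-cut vertex \<open>s\<close>, a new vertex
  \<open>u\<close> and \<open>k - 2\<close> others. By \<open>swap\<close>, the others go onto a
  member of \<open>R\<close> that contains the images of those placed already and is otherwise off
  the image. As \<open>u\<close> is new, it can take the vertex supplied by
  \<open>close\<close>.\<close>

lemma extend_by_edge:
  assumes f: "inj_on f Z" "finite Z" and S: "S \<subseteq> Z" "e \<inter> S = {s}"
    and e: "finite e" "card e = k" "u \<in> e" "u \<notin> Z" and M: "card (Z \<union> e) \<le> M"
    and R: "\<And>B. B \<in> R \<Longrightarrow> finite B \<and> card B = k - 2"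
    and swap: "\<And>B I W. B \<in> R \<Longrightarrow> I \<subseteq> B \<Longrightarrow> finite W \<Longrightarrow> card W \<le> M \<Longrightarrow> \<exists>B'\<in>R. I \<subseteq> B' \<and> (B' - I) \<inter> W = {}"
    and close: "\<And>B W. B \<in> R \<Longrightarrow> finite W \<Longrightarrow> card W \<le> M \<Longrightarrow> \<exists>z. z \<notin> W \<and> insert z (insert (f s) B) \<in> E"
    and B: "B \<in> R" "f ` (e \<inter> Z - S) \<subseteq> B"
  shows "\<exists>f'. inj_on f' (Z \<union> e) \<and> (\<forall>v\<in>Z. f' v = f v) \<and> f' ` e \<in> E \<and> f' ` (e - S - {u}) \<in> R"
proof -
  \<comment> \<open>Of the \<open>k - 2\<close> other vertices, \<open>J\<close> holds those already
    placed and \<open>N\<close> those still to be placed.\<close>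
  define J where "J = e \<inter> Z - S"
  define N where "N = e - Z - {u}"
  have ZM: "card Z \<le> M" using M card_mono[of "Z \<union> e" Z] f e by auto
  have "card (f ` Z) \<le> M" using card_image_le[OF f(2), of f] ZM by simp
  then obtain B' where B': "B' \<in> R" "f ` J \<subseteq> B'" "(B' - f ` J) \<inter> f ` Z = {}"
    using swap[OF B(1), of "f ` J" "f ` Z"] B(2) f(2) by (auto simp: J_def)
  have finB': "finite B'" and cB': "card B' = k - 2" using R[OF B'(1)] by auto
  have finJN: "finite J" "finite N" using e by (auto simp: J_def N_def)
  have seZ: "s \<in> e" "s \<in> Z" "s \<noteq> u" using S e by auto
  have JN: "e - S - {u} = J \<union> N" "J \<inter> N = {}" using S(1) e(4) by (auto simp: J_def N_def)
  have e_eq: "e = insert s (insert u (J \<union> N))" using S e by (auto simp: J_def N_def)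
  have "s \<notin> insert u (J \<union> N)" "u \<notin> J \<union> N" using S e seZ by (auto simp: J_def N_def)
  then have "card e = Suc (Suc (card (J \<union> N)))"
    using finJN by (subst e_eq) simp
  then have "card J + card N = k - 2" using e JN finJN by (simp add: card_Un_disjoint)
  moreover have "card (f ` J) = card J"
    using f(1) by (intro card_image) (auto simp: J_def inj_on_def)
  ultimately have "card N = card (B' - f ` J)"
    using cB' B'(2) finJN by (simp add: card_Diff_subset)
  then obtain h where h: "bij_betw h N (B' - f ` J)"
    using finJN finB' by (metis finite_Diff finite_same_card_bij)
  define f1 where "f1 v = (if v \<in> Z then f v else h v)" for v
  have f1N: "f1 ` N = B' - f ` J" using h by (auto simp: f1_def N_def bij_betw_def)
  have f1Z: "f1 v = f v" if "v \<in> Z" for v using that by (simp add: f1_def)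
  have f1J: "f1 ` J = f ` J" using f1Z by (auto simp: J_def)
  have inj1: "inj_on f1 (Z \<union> N)"
  proof -
    have "inj_on f1 Z" using f(1) f1Z by (simp add: inj_on_def)
    moreover have "inj_on f1 N" using h by (auto simp: f1_def N_def bij_betw_def inj_on_def)
    moreover have "f1 ` Z = f ` Z" using f1Z by auto
    ultimately show ?thesis using B'(3) f1N by (auto simp: inj_on_Un)
  qed
  have "card (f1 ` (Z \<union> N)) \<le> card (Z \<union> N)" using f finJN by (intro card_image_le) auto
  also have "\<dots> \<le> card (Z \<union> e)" using f e by (intro card_mono) (auto simp: N_def)
  finally have "card (f1 ` (Z \<union> N)) \<le> M" using M by simp
  then obtain z where z: "z \<notin> f1 ` (Z \<union> N)" "insert z (insert (f s) B') \<in> E"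
    using close[OF B'(1), of "f1 ` (Z \<union> N)"] f finJN by auto
  define f' where "f' = f1(u := z)"
  have uZN: "u \<notin> Z \<union> N" using e by (auto simp: N_def)
  have f'1: "f' v = f1 v" if "v \<in> Z \<union> N" for v using that uZN by (auto simp: f'_def)
  have "Z \<union> e = insert u (Z \<union> N)" using e by (auto simp: N_def)
  moreover have "inj_on f' (insert u (Z \<union> N))"
  proof -
    have "inj_on f' (Z \<union> N)" using inj1 f'1 by (simp add: inj_on_def)
    moreover have "f' u \<notin> f' ` (Z \<union> N)" using z f'1 by (simp add: f'_def image_def)
    ultimately show ?thesis using uZN by (simp add: inj_on_insert)
  qed
  moreover have "f' v = f v" if "v \<in> Z" for v using that f'1 f1Z by simp
  moreover have im: "f' ` (J \<union> N) = B'"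
  proof -
    have "f' ` (J \<union> N) = f1 ` (J \<union> N)" using f'1 by (intro image_cong) (auto simp: J_def)
    then show ?thesis using f1J f1N B'(2) by (auto simp: image_Un)
  qed
  moreover have "f' ` e = insert z (insert (f s) B')"
  proof -
    have "f' ` e = insert (f' s) (insert (f' u) (f' ` (J \<union> N)))" by (subst e_eq) simp
    moreover have "f' s = f s" using seZ f'1 f1Z by simp
    ultimately show ?thesis using im by (auto simp: f'_def)
  qed
  ultimately show ?thesis using z JN B'(1) by (intro exI[of _ f']) auto
qed

text \<open>All of \<open>S\<close> is placed before the first edge. The invariant is that each
  edge, without its vertex in \<open>S\<close> and its private vertex \<open>d e\<close>, lands on a
  member of \<open>R\<close>; the member belonging to the old edge \<open>f\<close> is the starting
  \<open>B\<close> for a new edge glued to \<open>f\<close>.\<close>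

lemma embed_along_cross_cut:
  assumes "hypertree H" "\<And>e. e \<in> edges H \<Longrightarrow> finite e \<and> card e = k"
    and "\<And>e. e \<in> edges H \<Longrightarrow> card (e \<inter> S) = 1"
    and "\<And>e. e \<in> edges H \<Longrightarrow> d e \<in> e - S"
    and "\<And>e e'. e \<in> edges H \<Longrightarrow> e' \<in> edges H \<Longrightarrow> e \<noteq> e' \<Longrightarrow> d e \<notin> e'"
    and "card (verts H \<union> S) \<le> M"
    and S: "finite S" "inj_on g S"
    and R: "R \<noteq> {}" "\<And>B. B \<in> R \<Longrightarrow> finite B \<and> card B = k - 2"
    and swap: "\<And>B I W. B \<in> R \<Longrightarrow> I \<subseteq> B \<Longrightarrow> finite W \<Longrightarrow> card W \<le> M \<Longrightarrow> \<exists>B'\<in>R. I \<subseteq> B' \<and> (B' - I) \<inter> W = {}"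
    and close: "\<And>B s W. B \<in> R \<Longrightarrow> s \<in> S \<Longrightarrow> finite W \<Longrightarrow> card W \<le> M \<Longrightarrow> \<exists>z. z \<notin> W \<and> insert z (insert (g s) B) \<in> E"
  shows "\<exists>f. inj_on f (verts H \<union> S) \<and> (\<forall>s\<in>S. f s = g s) \<and> (\<forall>e\<in>edges H. f ` e \<in> E \<and> f ` (e - S - {d e}) \<in> R)"
  using assms(1-6)
proof (induction rule: hypertree.induct)
  case (single e)
  obtain B where B: "B \<in> R" using R by auto
  have e: "finite e" "card e = k" "card (e \<inter> S) = 1" "d e \<in> e - S" "card (e \<union> S) \<le> M" using single by auto
  obtain s where s: "e \<inter> S = {s}" using e(3) by (auto simp: card_1_singleton_iff)
  have "\<exists>f'. inj_on f' (S \<union> e) \<and> (\<forall>v\<in>S. f' v = g v) \<and> f' ` e \<in> E \<and> f' ` (e - S - {d e}) \<in> R"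
  proof (rule extend_by_edge[where M=M and s=s and k=k and B=B])
    show "\<exists>z. z \<notin> W \<and> insert z (insert (g s) B) \<in> E" if "B \<in> R" "finite W" "card W \<le> M" for B W
      using close[OF that(1) _ that(2,3), of s] s by auto
  qed (use e s B S R(2) swap in \<open>auto simp: Un_commute\<close>)
  then show ?case by (auto simp: Un_commute)
next
  case (add_edge V E' e f)
  have VE: "V = \<Union>E'" "finite E'" using hypertree_verts[OF add_edge.hyps(1)] by auto
  have finV: "finite V" using VE add_edge.prems(1) by auto
  have e: "finite e" "card e = k" "card (e \<inter> S) = 1" "d e \<in> e - S" "card (V \<union> e \<union> S) \<le> M"
    using add_edge.prems(1,2,3)[of e] add_edge.prems(5) by auto
  obtain s where s: "e \<inter> S = {s}" using e(3) by (auto simp: card_1_singleton_iff)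
  have "card (V \<union> S) \<le> card (V \<union> e \<union> S)" using finV e(1) S(1) by (intro card_mono) auto
  then have cV: "card (V \<union> S) \<le> M" using e(5) by simp
  have "\<exists>f. inj_on f (verts (V, E') \<union> S) \<and> (\<forall>s\<in>S. f s = g s) \<and>
      (\<forall>e\<in>edges (V, E'). f ` e \<in> E \<and> f ` (e - S - {d e}) \<in> R)"
    by (rule add_edge.IH) (use add_edge.prems cV in auto)
  then obtain h where h: "inj_on h (V \<union> S)" "\<forall>s\<in>S. h s = g s"
    "\<forall>e\<in>E'. h ` e \<in> E \<and> h ` (e - S - {d e}) \<in> R" by auto
  have fE: "f \<in> E'" "e \<noteq> f" using add_edge.hyps by auto
  have deV: "d e \<notin> V" using VE add_edge.prems(4)[of e] add_edge.hyps(2) by auto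
  have dfe: "d f \<notin> e" using add_edge.prems(4)[of f e] fE by auto
  \<comment> \<open>The private vertex of \<open>f\<close> is not in \<open>e\<close>, so off
    \<open>S\<close> the overlap lies in the part of \<open>f\<close> whose image belongs to
    \<open>R\<close>.\<close>
  have "e \<inter> (V \<union> S) - S \<subseteq> f - S - {d f}" using add_edge.hyps(4) dfe by auto
  then have B: "h ` (e \<inter> (V \<union> S) - S) \<subseteq> h ` (f - S - {d f})" by blast
  have "\<exists>f'. inj_on f' ((V \<union> S) \<union> e) \<and> (\<forall>v\<in>V \<union> S. f' v = h v) \<and> f' ` e \<in> E \<and> f' ` (e - S - {d e}) \<in> R"
  proof (rule extend_by_edge[where M=M and s=s and k=k and B="h ` (f - S - {d f})"])
    show "card (V \<union> S \<union> e) \<le> M" using e(5) by (simp add: Un_ac)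
    show "\<exists>z. z \<notin> W \<and> insert z (insert (h s) B) \<in> E" if "B \<in> R" "finite W" "card W \<le> M" for B W
    proof -
      have "s \<in> S" using s by auto
      then show ?thesis using close[OF that(1) _ that(2,3), of s] h(2) by simp
    qed
  qed (use e s B h S R(2) swap fE finV deV in auto)
  then obtain f' where f': "inj_on f' ((V \<union> S) \<union> e)" "\<forall>v\<in>V \<union> S. f' v = h v" "f' ` e \<in> E" "f' ` (e - S - {d e}) \<in> R"
    by blast
  have "f' ` e' \<in> E \<and> f' ` (e' - S - {d e'}) \<in> R" if "e' \<in> E'" for e'
  proof -
    have "e' \<subseteq> V" using that VE by auto
    then have "f' ` e' = h ` e'" "f' ` (e' - S - {d e'}) = h ` (e' - S - {d e'})"
      using f'(2) by (auto intro!: image_cong)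
    then show ?thesis using h(3) that by auto
  qed
  moreover have "V \<union> e \<union> S = (V \<union> S) \<union> e" by auto
  ultimately show ?case using f' h(2) by (intro exI[of _ f']) auto
qed

text \<open>The elements of \<open>B\<close> outside \<open>I\<close> are exchanged one at a time.
  The element \<open>a\<close> missing from \<open>A\<close> leaves room: first a fresh
  \<open>z\<close> enters, which gives a member of \<open>Q\<close> again, and then the unwanted
  \<open>b\<close> leaves.\<close>

lemma swap_shadow:
  assumes Q: "\<And>A a W. A \<in> Q \<Longrightarrow> a \<in> A \<Longrightarrow> finite W \<Longrightarrow> card W \<le> M \<Longrightarrow>
      \<exists>z. z \<notin> W \<and> insert z (A - {a}) \<in> Q"
    and R: "R = {A - {a} |A a. A \<in> Q \<and> a \<in> A}"
    and B: "B \<in> R" "finite B" "I \<subseteq> B" and W: "finite W" "card W \<le> M"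
  shows "\<exists>B'\<in>R. I \<subseteq> B' \<and> (B' - I) \<inter> W = {}"
proof -
  have "\<exists>B'\<in>R. B - J \<subseteq> B' \<and> (B' - (B - J)) \<inter> W = {}" if "finite J" "J \<subseteq> B" for J
    using that
  proof (induction J rule: finite_induct)
    case empty
    then show ?case using B by auto
  next
    case (insert b J)
    then obtain B' where B': "B' \<in> R" "B - J \<subseteq> B'" "(B' - (B - J)) \<inter> W = {}" by auto
    then obtain A a where A: "A \<in> Q" "a \<in> A" "B' = A - {a}" using R by auto
    from Q[OF A(1,2) W] obtain z where z: "z \<notin> W" "insert z B' \<in> Q" using A by auto
    have "b \<in> B'" using insert B' by auto
    then have "insert z B' - {b} \<in> R" using z R by blast
    moreover have "B - insert b J \<subseteq> insert z B' - {b}" using B' by auto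
    moreover have "(insert z B' - {b} - (B - insert b J)) \<inter> W = {}" using B' z by auto
    ultimately show ?case by blast
  qed
  from this[of "B - I"] B show ?thesis by (auto simp: double_diff)
qed

subsection \<open>Counting\<close>

text \<open>Count the pairs \<open>p \<subseteq> e\<close> in two ways; an edge has only
  \<open>Suc m\<close> subsets of size \<open>m\<close>.\<close>

lemma double_count_shadow:
  assumes "finite V" "P \<subseteq> nsets V m" "E \<subseteq> nsets V (Suc m)" "\<And>p. p \<in> P \<Longrightarrow> r \<le> real (card {e \<in> E. p \<subseteq> e})"
  shows "real (card P) * r \<le> real (Suc m) * real (card E)"
proof -
  have fin: "finite P" "finite E" using assms finite_imp_finite_nsets finite_subset by metis+
  have "real (card P) * r = (\<Sum>p\<in>P. r)" by simp
  also have "\<dots> \<le> (\<Sum>p\<in>P. real (card {e \<in> E. p \<subseteq> e}))" using assms by (intro sum_mono)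
  also have "\<dots> = (\<Sum>p\<in>P. \<Sum>e\<in>{e. e \<in> E \<and> p \<subseteq> e}. 1)" by simp
  also have "\<dots> = (\<Sum>e\<in>E. \<Sum>p\<in>{p. p \<in> P \<and> p \<subseteq> e}. 1)" using fin by (rule sum.swap_restrict)
  also have "\<dots> = (\<Sum>e\<in>E. real (card {p \<in> P. p \<subseteq> e}))" by simp
  also have "\<dots> \<le> (\<Sum>e\<in>E. real (Suc m))"
  proof (rule sum_mono)
    fix e assume "e \<in> E"
    then have e: "finite e" "card e = Suc m" using assms by (auto simp: nsets_def)
    have "card {p \<in> P. p \<subseteq> e} \<le> card (nsets e m)"
      using e assms by (intro card_mono finite_imp_finite_nsets) (auto simp: nsets_def)
    also have "\<dots> = Suc m" using e by (simp add: binomial_Suc_n)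
    finally show "real (card {p \<in> P. p \<subseteq> e}) \<le> real (Suc m)" by simp
  qed
  finally show ?thesis by (simp add: mult.commute)
qed

lemma card_insert_le_supersets:
  assumes "finite P" "X \<subseteq> {x. x \<notin> B \<and> insert x B \<in> P}"
  shows "finite X \<and> card X \<le> card {p \<in> P. B \<subseteq> p}"
proof -
  have inj: "inj_on (\<lambda>x. insert x B) X" using assms(2) by (auto simp: inj_on_def)
  have sub: "(\<lambda>x. insert x B) ` X \<subseteq> {p \<in> P. B \<subseteq> p}" using assms(2) by auto
  have fin: "finite {p \<in> P. B \<subseteq> p}" using assms by auto
  show ?thesis using inj sub fin by (metis card_inj_on_le finite_imageD finite_subset)
qed

lemma card_PiE_image_le:
  assumes "finite J" "finite P" "\<And>p. p \<in> P \<Longrightarrow> finite p \<and> card p \<le> m"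
  shows "card {\<psi> \<in> J \<rightarrow>\<^sub>E V. \<psi> ` J \<in> P} \<le> card P * m ^ card J"
proof -
  have "{\<psi> \<in> J \<rightarrow>\<^sub>E V. \<psi> ` J \<in> P} \<subseteq> (\<Union>p\<in>P. J \<rightarrow>\<^sub>E p)" by (auto simp: PiE_def Pi_def)
  moreover have "finite (\<Union>p\<in>P. J \<rightarrow>\<^sub>E p)" using assms by (auto intro!: finite_PiE)
  ultimately have "card {\<psi> \<in> J \<rightarrow>\<^sub>E V. \<psi> ` J \<in> P} \<le> card (\<Union>p\<in>P. J \<rightarrow>\<^sub>E p)" by (rule card_mono[rotated])
  also have "\<dots> \<le> (\<Sum>p\<in>P. card (J \<rightarrow>\<^sub>E p))" using assms by (intro card_UN_le)
  also have "\<dots> \<le> (\<Sum>p\<in>P. m ^ card J)"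
    using assms by (intro sum_mono) (simp add: card_PiE power_mono)
  finally show ?thesis by simp
qed

text \<open>Each function is charged to a vertex of \<open>W\<close> that it takes at
  \<open>i\<close> or at \<open>j\<close>, which makes two slices for every vertex of
  \<open>W\<close>.\<close>

lemma card_le_slices:
  assumes "finite W" "card W \<le> M" "\<And>\<phi>. \<phi> \<in> S \<Longrightarrow> \<phi> i \<in> W \<or> \<phi> j \<in> W"
    and "finite S" "0 \<le> r" "\<And>w. real (card {\<phi> \<in> S. \<phi> i = w}) \<le> r" "\<And>w. real (card {\<phi> \<in> S. \<phi> j = w}) \<le> r"
  shows "real (card S) \<le> 2 * real M * r"
proof -
  have "S \<subseteq> (\<Union>w\<in>W. {\<phi> \<in> S. \<phi> i = w} \<union> {\<phi> \<in> S. \<phi> j = w})" using assms(3) by auto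
  then have "card S \<le> card (\<Union>w\<in>W. {\<phi> \<in> S. \<phi> i = w} \<union> {\<phi> \<in> S. \<phi> j = w})"
    using assms by (intro card_mono) auto
  also have "\<dots> \<le> (\<Sum>w\<in>W. card ({\<phi> \<in> S. \<phi> i = w} \<union> {\<phi> \<in> S. \<phi> j = w}))" using assms by (intro card_UN_le)
  finally have "real (card S) \<le> (\<Sum>w\<in>W. real (card ({\<phi> \<in> S. \<phi> i = w} \<union> {\<phi> \<in> S. \<phi> j = w})))"
    by (simp only: of_nat_sum[symmetric] of_nat_le_iff)
  also have "\<dots> \<le> (\<Sum>w\<in>W. 2 * r)"
  proof (rule sum_mono)
    fix w
    have "real (card ({\<phi> \<in> S. \<phi> i = w} \<union> {\<phi> \<in> S. \<phi> j = w})) \<le>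
      real (card {\<phi> \<in> S. \<phi> i = w}) + real (card {\<phi> \<in> S. \<phi> j = w})"
      by (simp only: of_nat_add[symmetric] of_nat_le_iff card_Un_le)
    then show "real (card ({\<phi> \<in> S. \<phi> i = w} \<union> {\<phi> \<in> S. \<phi> j = w})) \<le> 2 * r"
      using assms(6,7)[of w] by linarith
  qed
  also have "\<dots> = real (card W) * (2 * r)" by simp
  also have "\<dots> \<le> real M * (2 * r)" using assms by (intro mult_right_mono) auto
  finally show ?thesis by (simp add: mult_ac)
qed

lemma sum_Pow_power_card:
  fixes x :: real
  assumes "finite A"
  shows "(\<Sum>S\<in>Pow A. x ^ card S) = (1 + x) ^ card A"
  using assms
proof (induction A rule: finite_induct)
  case (insert a A)
  have fin: "\<And>S. S \<in> Pow A \<Longrightarrow> finite S \<and> a \<notin> S" using insert finite_subset by auto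
  have "(\<Sum>S\<in>Pow (insert a A). x ^ card S) = (\<Sum>S\<in>Pow A. x ^ card S) + (\<Sum>S\<in>insert a ` Pow A. x ^ card S)"
    unfolding Pow_insert using insert by (intro sum.union_disjoint) auto
  also have "(\<Sum>S\<in>insert a ` Pow A. x ^ card S) = (\<Sum>S\<in>Pow A. x ^ card (insert a S))"
    using insert by (subst sum.reindex) (auto simp: inj_on_def)
  also have "\<dots> = (\<Sum>S\<in>Pow A. x * x ^ card S)"
    using fin by (intro sum.cong) auto
  also have "\<dots> = x * (\<Sum>S\<in>Pow A. x ^ card S)" by (simp add: sum_distrib_left)
  finally show ?case using insert by (simp add: algebra_simps)
qed simp

text \<open>Weight each subset by \<open>x ^ card S\<close>: a small subset weighs at least
  \<open>x ^ m\<close>, and the total weight is \<open>(1 + x) ^ card A\<close>, at most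
  \<open>exp (x * card A)\<close>. The parameter \<open>x\<close> is tuned separately for each part
  of the encoding.\<close>

lemma card_small_subsets:
  fixes x :: real
  assumes "finite A" "0 < x" "x \<le> 1"
  shows "real (card {S. S \<subseteq> A \<and> card S \<le> m}) \<le> (1 / x) ^ m * exp (x * real (card A))"
proof -
  let ?T = "{S. S \<subseteq> A \<and> card S \<le> m}"
  have "real (card ?T) * x ^ m = (\<Sum>S\<in>?T. x ^ m)" by simp
  also have "\<dots> \<le> (\<Sum>S\<in>?T. x ^ card S)" using assms by (intro sum_mono power_decreasing) auto
  also have "\<dots> \<le> (\<Sum>S\<in>Pow A. x ^ card S)" using assms by (intro sum_mono2) auto
  also have "\<dots> = (1 + x) ^ card A" by (rule sum_Pow_power_card[OF assms(1)])
  also have "\<dots> \<le> exp x ^ card A" using assms by (intro power_mono exp_ge_add_one_self) auto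
  also have "\<dots> = exp (x * real (card A))" by (simp add: exp_of_nat2_mult)
  finally show ?thesis using assms by (simp add: field_simps)
qed

text \<open>By Pascal's rule the upper index drops by one at a cost of at most
  \<open>n ^ j\<close>.\<close>

lemma choose_le_shifted:
  assumes "s \<le> n"
  shows "n choose Suc j \<le> ((n - s) choose Suc j) + s * n ^ j"
  using assms
proof (induction s)
  case (Suc s)
  define m where "m = n - Suc s"
  have m: "n - s = Suc m" using Suc.prems by (simp add: m_def)
  have "m choose j \<le> n ^ j"
  proof (cases "j \<le> m")
    case True
    then have "m choose j \<le> m ^ j" by (rule binomial_le_pow)
    also have "\<dots> \<le> n ^ j" by (intro power_mono) (auto simp: m_def)
    finally show ?thesis .
  qed (simp add: binomial_eq_0)
  then show ?case using Suc m by (simp add: m_def)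
qed simp

subsection \<open>Edge sets without a 2-contractible tree\<close>

locale contractible_tree =
  fixes k :: nat and H :: "'a hypergraph"
  assumes k_ge: "4 \<le> k" and tree: "k_tree k H" and contractible: "two_contractible H"
begin

text \<open>A partial embedding of \<open>H\<close> occupies at most this many vertices, so each
  greedy step must be able to avoid that many.\<close>

definition M :: nat where "M = card (verts H)"

definition leaves :: "'a set" where "leaves = {v. degree H v = 1}"

lemma hyper: "hypertree H"
  using tree by (simp add: k_tree_def)

lemma verts_eq: "verts H = \<Union>(edges H)" and finite_edges: "finite (edges H)" and edges_nonempty: "edges H \<noteq> {}"
  using hypertree_verts[OF hyper] by auto

lemma edge_card: "e \<in> edges H \<Longrightarrow> finite e \<and> card e = k"
  using tree by (auto simp: k_tree_def k_graph_def nsets_def)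

lemma finite_verts: "finite (verts H)"
  using verts_eq finite_edges edge_card by auto

lemma leaves_in_edge: "e \<in> edges H \<Longrightarrow> 2 \<le> card (e \<inter> leaves)"
  using contractible by (auto simp: two_contractible_def leaves_def Int_def)

lemma leaves_unique_edge:
  assumes "e \<in> edges H" "e' \<in> edges H" "e \<noteq> e'"
  shows "e \<inter> e' \<inter> leaves = {}"
proof (rule ccontr)
  assume "e \<inter> e' \<inter> leaves \<noteq> {}"
  then obtain v where v: "v \<in> e" "v \<in> e'" "card {e \<in> edges H. v \<in> e} = 1"
    by (auto simp: leaves_def degree_def)
  then obtain x where "{e \<in> edges H. v \<in> e} = {x}" by (auto simp: card_1_singleton_iff)
  then show False using v assms by (metis (mono_tags, lifting) mem_Collect_eq singletonD)
qed

text \<open>The greedy embedding with the degree-one vertices as \<open>D\<close>. It is used by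
  contradiction: an edge set without a copy of \<open>H\<close> has no nonempty replaceable family
  of orderings.\<close>

lemma copy_of_replaceable:
  assumes "replaceable k M F" "F \<noteq> {}" "\<And>\<phi>. \<phi> \<in> F \<Longrightarrow> inj_on \<phi> {..<k} \<and> \<phi> ` {..<k} \<in> E" "E \<subseteq> nsets V k"
  shows "contains_copy (V, E) H"
proof -
  have "\<exists>f. inj_on f (verts H) \<and> (\<forall>e\<in>edges H. \<exists>\<phi>\<in>F. \<exists>b. bij_betw b e {..<k} \<and>
           (\<forall>v\<in>e. f v = \<phi> (b v)) \<and> (\<forall>v\<in>e. b v < 2 \<longrightarrow> v \<in> leaves))"
    by (rule embed_replaceable[OF hyper edge_card leaves_in_edge leaves_unique_edge _ assms(1,2)])
      (use assms(3) in \<open>auto simp: M_def\<close>)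
  then obtain f where f: "inj_on f (verts H)"
    "\<forall>e\<in>edges H. \<exists>\<phi>\<in>F. \<exists>b. bij_betw b e {..<k} \<and>
      (\<forall>v\<in>e. f v = \<phi> (b v)) \<and> (\<forall>v\<in>e. b v < 2 \<longrightarrow> v \<in> leaves)"
    by (elim exE conjE)
  have "f ` e \<in> E" if e: "e \<in> edges H" for e
  proof -
    obtain \<phi> b where \<phi>: "\<phi> \<in> F" "bij_betw b e {..<k}" "\<forall>v\<in>e. f v = \<phi> (b v)" using f(2) e by blast
    then have "f ` e = \<phi> ` (b ` e)" by (auto simp: image_image)
    then show ?thesis using \<phi> assms(3) by (auto simp: bij_betw_def)
  qed
  then show ?thesis using contains_copyI[OF f(1) verts_eq assms(4)] by blast
qed

section \<open>Covering an \<open>H\<close>-free edge set by few candidates\<close>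

text \<open>If no such \<open>B\<close> existed, every \<open>(k - 2)\<close>-subset of an edge
  would extend to an edge whose two further vertices avoid any given set of at most \<open>M\<close>
  vertices. Then the family of all orderings of edges would be replaceable, two positions at a
  time.\<close>

lemma ex_light:
  fixes V :: "'b set"
  assumes "E \<subseteq> nsets V k" "E \<noteq> {}" "\<not> contains_copy (V, E) H"
  shows "\<exists>B\<in>nsets V (k - 2). (\<exists>e\<in>E. B \<subseteq> e) \<and>
           (\<exists>W. finite W \<and> card W \<le> M \<and> (\<forall>e\<in>E. B \<subseteq> e \<longrightarrow> (e - B) \<inter> W \<noteq> {}))"
proof (rule ccontr)
  assume neg: "\<not> ?thesis"
  have heavy: "\<exists>e\<in>E. B \<subseteq> e \<and> (e - B) \<inter> W = {}"
    if "B \<in> nsets V (k - 2)" "\<exists>e\<in>E. B \<subseteq> e" "finite W" "card W \<le> M" for B W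
  proof (rule ccontr)
    assume "\<not> ?thesis"
    then have "\<forall>e\<in>E. B \<subseteq> e \<longrightarrow> (e - B) \<inter> W \<noteq> {}" by simp
    then show False using neg that by (metis (no_types, lifting))
  qed
  define F where "F = {\<phi>. inj_on \<phi> {..<k} \<and> \<phi> ` {..<k} \<in> E}"
  have "F \<noteq> {}"
  proof -
    obtain e where "e \<in> E" using assms by auto
    then have "finite e" "card e = k" using assms by (auto simp: nsets_def)
    then obtain \<phi> where "bij_betw \<phi> {..<k} e"
      using ex_bij_betw_nat_finite[of e] by (auto simp: atLeast0LessThan)
    then show ?thesis using \<open>e \<in> E\<close> by (auto simp: F_def bij_betw_def)
  qed
  moreover have "replaceable k M F"
    unfolding replaceable_def
  proof (intro ballI allI impI)
    fix \<phi> i and W :: "'b set" assume \<phi>: "\<phi> \<in> F" and i: "i < k" and W: "finite W" "card W \<le> M"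
    \<comment> \<open>The pair \<open>{0, j}\<close> contains \<open>i\<close> and lies in
      \<open>{0, 1, i}\<close>; two positions have to be freed, as \<open>B\<close> has
      \<open>k - 2\<close> elements.\<close>
    define j where "j = (if i = 0 then 1 else i)"
    have j: "j < k" "j \<noteq> 0" using i k_ge by (auto simp: j_def)
    define B where "B = \<phi> ` ({..<k} - {0, j})"
    have inj: "inj_on \<phi> {..<k}" and im: "\<phi> ` {..<k} \<in> E" using \<phi> by (auto simp: F_def)
    have inj': "inj_on \<phi> ({..<k} - {0, j})" using inj by (rule inj_on_subset) auto
    have "card ({..<k} - {0, j}) = k - 2" using j by (subst card_Diff_subset) auto
    then have cB: "card B = k - 2" unfolding B_def using card_image[OF inj'] by simp
    have Be: "B \<subseteq> \<phi> ` {..<k}" by (auto simp: B_def)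
    then have BV: "B \<in> nsets V (k - 2)" using im assms cB by (auto simp: nsets_def B_def)
    have "\<exists>e\<in>E. B \<subseteq> e" using im Be by blast
    from heavy[OF BV this W] obtain e where e: "e \<in> E" "B \<subseteq> e" "(e - B) \<inter> W = {}" by blast
    have "finite e" "card e = k" using e assms by (auto simp: nsets_def)
    then have "card (e - B) = 2" using e cB k_ge by (subst card_Diff_subset) (auto intro: finite_subset)
    then obtain p q where pq: "p \<noteq> q" "e - B = {p, q}" by (auto simp: card_2_iff)
    define \<psi> where "\<psi> = \<phi>(0 := p, j := q)"
    have split: "{..<k} = ({..<k} - {0, j}) \<union> {0, j}" using j by auto
    have same: "\<psi> l = \<phi> l" if "l \<in> {..<k} - {0, j}" for l using that by (auto simp: \<psi>_def)
    then have im1: "\<psi> ` ({..<k} - {0, j}) = B" by (auto simp: B_def)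
    have im2: "\<psi> ` {0, j} = {p, q}" using j by (auto simp: \<psi>_def)
    have "\<psi> ` {..<k} = B \<union> {p, q}" using im1 im2 split by (metis image_Un)
    also have "\<dots> = e" using e pq by auto
    finally have "\<psi> ` {..<k} = e" .
    moreover from this have "inj_on \<psi> {..<k}" using \<open>card e = k\<close> by (simp add: eq_card_imp_inj_on)
    ultimately have "\<psi> \<in> F" using e by (simp add: F_def)
    moreover have "\<forall>l\<in>{0, j}. \<psi> l \<notin> W" using im2 pq e by auto
    moreover have "i \<in> {0, j}" "{0, j} \<subseteq> {0, 1, i}" by (auto simp: j_def)
    ultimately show "\<exists>U. \<exists>\<psi>\<in>F. i \<in> U \<and> U \<subseteq> {0, 1, i} \<and> (\<forall>j\<in>{..<k} - U. \<psi> j = \<phi> j) \<and> (\<forall>j\<in>U. \<psi> j \<notin> W)"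
      using same by (intro exI[of _ "{0, j}"] bexI[of _ \<psi>]) auto
  qed
  moreover have "inj_on \<phi> {..<k} \<and> \<phi> ` {..<k} \<in> E" if "\<phi> \<in> F" for \<phi>
    using that by (simp add: F_def)
  ultimately have "contains_copy (V, E) H"
    using copy_of_replaceable[OF _ _ _ assms(1)] by blast
  then show False using assms by blast
qed

text \<open>In the encoding, \<open>Y\<close> is recorded instead of the edges: \<open>Y B\<close>
  is a bounded set that hits the edges peeled off with \<open>B\<close>.\<close>

definition covered :: "nat set \<Rightarrow> (nat set \<Rightarrow> nat set) \<Rightarrow> nat set set" where
  "covered V Y = {e \<in> nsets V k. \<exists>B\<in>nsets V (k - 2). B \<subseteq> e \<and> (e - B) \<inter> Y B \<noteq> {}}"

text \<open>Repeatedly delete the edges through the set \<open>B\<close> found by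
  \<open>ex_light\<close> and record their hitting set as \<open>Y B\<close>; what remains is still
  free of \<open>H\<close>, so \<open>ex_light\<close> applies again.\<close>

lemma light_cover:
  assumes "finite V" "E \<subseteq> nsets V k" "\<not> contains_copy (V, E) H"
  shows "\<exists>Y. (\<forall>B. Y B \<subseteq> V \<and> card (Y B) \<le> M) \<and> E \<subseteq> covered V Y"
proof -
  have "finite E" using assms by (meson finite_imp_finite_nsets finite_subset)
  then show ?thesis using assms(2,3)
  proof (induction E rule: finite_psubset_induct)
    case (psubset E)
    show ?case
    proof (cases "E = {}")
      case True
      then show ?thesis by (auto intro!: exI[of _ "\<lambda>_. {}"])
    next
      case False
      from ex_light[OF psubset.prems(1) False psubset.prems(2)] obtain B W where
        B: "B \<in> nsets V (k - 2)" "\<exists>e\<in>E. B \<subseteq> e" and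
        W: "finite W" "card W \<le> M" "\<forall>e\<in>E. B \<subseteq> e \<longrightarrow> (e - B) \<inter> W \<noteq> {}" by blast
      define E' where "E' = {e \<in> E. \<not> B \<subseteq> e}"
      have "E' \<subset> E" using B(2) by (auto simp: E'_def)
      moreover have "\<not> contains_copy (V, E') H"
        using contains_copy_mono[of V E' H E] psubset.prems by (auto simp: E'_def)
      moreover have "E' \<subseteq> nsets V k" using psubset.prems(1) by (auto simp: E'_def)
      ultimately obtain Y where Y: "\<forall>B. Y B \<subseteq> V \<and> card (Y B) \<le> M" "E' \<subseteq> covered V Y"
        using psubset.IH[of E'] by blast
      \<comment> \<open>Overwriting the value at \<open>B\<close> is harmless, since no edge of
        \<open>E'\<close> contains \<open>B\<close>. Intersecting with \<open>V\<close> loses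
        nothing, since edges lie in \<open>V\<close>.\<close>
      define Y' where "Y' = Y(B := W \<inter> V)"
      have "card (W \<inter> V) \<le> M" using W card_mono[of W "W \<inter> V"] by auto
      then have 1: "\<forall>B. Y' B \<subseteq> V \<and> card (Y' B) \<le> M" using Y(1) by (auto simp: Y'_def)
      have "e \<in> covered V Y'" if e: "e \<in> E" for e
      proof (cases "B \<subseteq> e")
        case True
        have "e \<in> nsets V k" "e \<subseteq> V" using e psubset.prems by (auto simp: nsets_def)
        moreover have "(e - B) \<inter> Y' B \<noteq> {}" using W(3) e True \<open>e \<subseteq> V\<close> by (auto simp: Y'_def)
        ultimately show ?thesis using B True by (auto simp: covered_def)
      next
        case False
        then have "e \<in> covered V Y" using e Y(2) by (auto simp: E'_def)
        then show ?thesis using False by (auto simp: covered_def Y'_def)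
      qed
      then show ?thesis using 1 by blast
    qed
  qed
qed

text \<open>A covered edge is \<open>B\<close> together with a vertex of \<open>Y B\<close> and one
  arbitrary vertex: at most \<open>card V ^ (k - 2)\<close>, \<open>M\<close> and
  \<open>card V\<close> choices.\<close>

lemma card_covered:
  assumes "finite V" "\<And>B. B \<in> nsets V (k - 2) \<Longrightarrow> Y B \<subseteq> V \<and> card (Y B) \<le> M"
  shows "finite (covered V Y)" "card (covered V Y) \<le> M * card V ^ (k - 1)"
proof -
  show "finite (covered V Y)" using assms by (auto simp: covered_def finite_imp_finite_nsets)
  define T where "T = Sigma (nsets V (k - 2)) (\<lambda>B. Y B \<times> V)"
  have finY: "finite (Y B)" if "B \<in> nsets V (k - 2)" for B using assms that finite_subset by blast
  have "covered V Y \<subseteq> (\<lambda>(B, y, z). insert y (insert z B)) ` T"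
  proof
    fix e assume "e \<in> covered V Y"
    then obtain B y where e: "e \<in> nsets V k" "B \<in> nsets V (k - 2)" "B \<subseteq> e" "y \<in> e - B" "y \<in> Y B"
      by (auto simp: covered_def)
    have "finite B" "card B = k - 2" "card e = k" using e by (auto simp: nsets_def)
    then have "card (e - B) = 2" using e k_ge by (simp add: card_Diff_subset)
    then have "card (e - B - {y}) = 1" using e by (simp add: card_Diff_singleton)
    then obtain z where "e - B - {y} = {z}" by (auto simp: card_1_singleton_iff)
    then have "e = insert y (insert z B)" "z \<in> V" using e by (auto simp: nsets_def)
    then show "e \<in> (\<lambda>(B, y, z). insert y (insert z B)) ` T" using e 
      by (intro image_eqI[of _ _ "(B, y, z)"]) (auto simp: T_def)
  qed
  moreover have finT: "finite T" using assms finY by (auto simp: T_def finite_imp_finite_nsets)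
  ultimately have "card (covered V Y) \<le> card T" by (meson card_image_le card_mono finite_imageI le_trans)
  also have "card T = (\<Sum>B\<in>nsets V (k - 2). card (Y B) * card V)"
    unfolding T_def using assms finY by (subst card_SigmaI) (auto simp: card_cartesian_product finite_imp_finite_nsets)
  also have "\<dots> \<le> (\<Sum>B\<in>nsets V (k - 2). M * card V)"
    using assms by (intro sum_mono mult_right_mono) auto
  also have "\<dots> \<le> card V ^ (k - 2) * (M * card V)"
    using card_nsets_le_power[OF assms(1)] by simp
  also have "\<dots> = M * card V ^ (k - 1)"
  proof -
    have "k - 1 = Suc (k - 2)" using k_ge by simp
    then show ?thesis by (simp add: mult_ac)
  qed
  finally show "card (covered V Y) \<le> M * card V ^ (k - 1)" .
qed

text \<open>The data \<open>P = rich r V E\<close> determine the family \<open>stars L V P\<close>, which will contain almost all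
  edges of \<open>E\<close>. Excluding the crowded sets bounds the number of centres of each \<open>A\<close> by \<open>L\<close>.\<close>

definition rich :: "real \<Rightarrow> nat set \<Rightarrow> nat set set \<Rightarrow> nat set set" where
  "rich r V E = {p \<in> nsets V (k - 1). r \<le> real (card {e \<in> E. p \<subseteq> e})}"

definition crowded :: "nat \<Rightarrow> nat set \<Rightarrow> nat set set \<Rightarrow> nat set set" where
  "crowded L V P = {B \<in> nsets V (k - 2). L < card {p \<in> P. B \<subseteq> p}}"

definition centres :: "nat \<Rightarrow> nat set \<Rightarrow> nat set set \<Rightarrow> nat set \<Rightarrow> nat set" where
  "centres L V P A = {x \<in> V - A. \<forall>a\<in>A. insert x (A - {a}) \<in> P \<and> A - {a} \<notin> crowded L V P}"

definition stars :: "nat \<Rightarrow> nat set \<Rightarrow> nat set set \<Rightarrow> nat set set" where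
  "stars L V P = (\<Union>A\<in>nsets V (k - 1). (\<lambda>x. insert x A) ` centres L V P A)"

lemma card_rich:
  assumes "finite V" "E \<subseteq> nsets V k"
  shows "real (card (rich r V E)) * r \<le> real k * real (card E)"
proof -
  have k: "Suc (k - 1) = k" using k_ge by simp
  have "real (card (rich r V E)) * r \<le> real (Suc (k - 1)) * real (card E)"
    by (rule double_count_shadow[of V]) (use assms k in \<open>auto simp: rich_def\<close>)
  then show ?thesis by (simp only: k)
qed

lemma card_crowded:
  assumes "finite V" "P \<subseteq> nsets V (k - 1)"
  shows "real (card (crowded L V P)) * real L \<le> real k * real (card P)"
proof -
  have k: "Suc (k - 2) = k - 1" using k_ge by simp
  have "real (card (crowded L V P)) * real L \<le> real (Suc (k - 2)) * real (card P)"
    by (rule double_count_shadow[of V]) (use assms k in \<open>auto simp: crowded_def\<close>)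
  also have "\<dots> \<le> real k * real (card P)" using k by (intro mult_right_mono) auto
  finally show ?thesis .
qed

text \<open>Fix one \<open>a\<close> in \<open>A\<close>. Different centres \<open>x\<close> yield
  different members \<open>insert x (A - {a})\<close> of \<open>P\<close> above
  \<open>A - {a}\<close>, which is not crowded.\<close>

lemma card_centres:
  assumes "finite V" "P \<subseteq> nsets V (k - 1)" "A \<in> nsets V (k - 1)"
  shows "finite (centres L V P A)" "card (centres L V P A) \<le> L"
proof -
  show fin: "finite (centres L V P A)" using assms by (auto simp: centres_def)
  show "card (centres L V P A) \<le> L"
  proof (cases "centres L V P A = {}")
    case False
    have A: "finite A" "card A = k - 1" "A \<subseteq> V" using assms by (auto simp: nsets_def)
    then obtain a where a: "a \<in> A" using k_ge by fastforce
    have "A - {a} \<in> nsets V (k - 2)" using A a by (auto simp: nsets_def)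
    moreover have "A - {a} \<notin> crowded L V P" using False a by (auto simp: centres_def)
    ultimately have L: "card {p \<in> P. A - {a} \<subseteq> p} \<le> L" by (auto simp: crowded_def)
    have "finite P" using assms finite_subset finite_imp_finite_nsets by metis
    then show ?thesis using card_insert_le_supersets[of P "centres L V P A" "A - {a}"] L a
      by (force simp: centres_def)
  qed simp
qed

text \<open>Extensionality puts the ordering into the finite space
  \<open>{..<k} \<rightarrow>\<^sub>E V\<close> in which orderings are counted.\<close>

lemma ordering_of_edge:
  assumes "finite e" "card e = k" "x \<in> e" "y \<in> e" "x \<noteq> y"
  shows "\<exists>\<phi>. bij_betw \<phi> {..<k} e \<and> \<phi> 0 = x \<and> \<phi> 1 = y \<and> \<phi> \<in> extensional {..<k}"
proof -
  have "card {2..<k} = card (e - {x, y})" using assms by (simp add: card_Diff_subset)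
  then obtain h where h: "bij_betw h {2..<k} (e - {x, y})"
    using assms by (metis finite_Diff finite_atLeastLessThan finite_same_card_bij)
  define \<phi> where "\<phi> i = (if i = 0 then x else if i = 1 then y else if i < k then h i else undefined)" for i
  have "bij_betw \<phi> {2..<k} (e - {x, y})"
    using h by (rule bij_betw_cong[THEN iffD1, rotated]) (auto simp: \<phi>_def)
  moreover have "bij_betw \<phi> {0, 1} {x, y}" using assms by (auto simp: bij_betw_def \<phi>_def)
  ultimately have "bij_betw \<phi> ({2..<k} \<union> {0, 1}) ((e - {x, y}) \<union> {x, y})"
    by (rule bij_betw_combine) auto
  moreover have "{2..<k} \<union> {0, 1} = {..<k}" using k_ge by auto
  moreover have "(e - {x, y}) \<union> {x, y} = e" using assms by auto
  ultimately have "bij_betw \<phi> {..<k} e" by simp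
  moreover have "\<phi> \<in> extensional {..<k}" using k_ge by (auto simp: \<phi>_def extensional_def)
  ultimately show ?thesis by (intro exI[of _ \<phi>]) (auto simp: \<phi>_def)
qed

section \<open>Edges outside the stars\<close>

text \<open>Every edge outside the stars has an ordering each of whose positions can be replaced for
  one of three reasons. Peeling these orderings leaves a replaceable family, which is empty because
  \<open>E\<close> contains no copy of \<open>H\<close>; so their number is at most the total
  peeling cost, one summand for each reason.\<close>

lemma card_outside_stars:
  assumes V: "finite V" and E: "E \<subseteq> nsets V k" and free: "\<not> contains_copy (V, E) H" and r: "0 \<le> r"
    and P: "P = rich r V E" and C: "C = crowded L V P"
  shows "real (card (E - stars L V P)) \<le> real (k * (card P * k ^ k)) * real M
     + real (k * card V ^ (k - 2)) * (2 * real M * r) + real (card C * k ^ k) * (2 * real M * real (card V))"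
proof -
  \<comment> \<open>The three reasons: \<open>i\<close> is changed alone and the rest of the edge
    lies in the small family \<open>P\<close>; positions 0 and \<open>j\<close> are changed together
    and neither \<open>(k - 1)\<close>-set omitting one of them is in \<open>P\<close>; positions 0
    and 1 are changed together and the rest lies in the small family \<open>C\<close>.\<close>
  define ok where "ok e \<phi> i \<longleftrightarrow> e - {\<phi> i} \<in> P \<or>
    (\<exists>j\<in>{1..<k}. i \<in> {0, j} \<and> {0, j} \<subseteq> {0, 1, i} \<and> e - {\<phi> 0} \<notin> P \<and> e - {\<phi> j} \<notin> P) \<or>
    (i < 2 \<and> e - {\<phi> 0, \<phi> 1} \<in> C)" for e and \<phi> :: "nat \<Rightarrow> nat" and i :: nat
  define F where "F = {\<phi> \<in> {..<k} \<rightarrow>\<^sub>E V. inj_on \<phi> {..<k} \<and> \<phi> ` {..<k} \<in> E \<and> (\<forall>i<k. ok (\<phi> ` {..<k}) \<phi> i)}"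
  have PV: "P \<subseteq> nsets V (k - 1)" by (auto simp: P rich_def)
  have CV: "C \<subseteq> nsets V (k - 2)" by (auto simp: C crowded_def)
  have finPC: "finite P" "finite C" using PV CV V finite_imp_finite_nsets finite_subset by metis+
  have finF: "finite F" using V by (auto simp: F_def intro: finite_subset[OF _ finite_PiE[of "{..<k}" "\<lambda>_. V"]])
  have diff: "\<phi> ` ({..<k} - U) = \<phi> ` {..<k} - \<phi> ` U" if "\<phi> \<in> F" "U \<subseteq> {..<k}" for \<phi> U
    using that by (intro inj_on_image_set_diff[where C="{..<k}"]) (auto simp: F_def)

  have "E - stars L V P \<subseteq> (\<lambda>\<phi>. \<phi> ` {..<k}) ` F"
  proof
    fix e assume e: "e \<in> E - stars L V P"
    then have eV: "finite e" "card e = k" "e \<subseteq> V" using E by (auto simp: nsets_def)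
    \<comment> \<open>As \<open>e\<close> is not a star, \<open>x\<close> is not a centre of
      \<open>e - {x}\<close>, and some \<open>a\<close> witnesses this.\<close>
    have star: "\<exists>a\<in>e - {x}. e - {a} \<notin> P \<or> e - {x, a} \<in> C" if x: "x \<in> e" for x
    proof (rule ccontr)
      assume neg: "\<not> ?thesis"
      have A: "e - {x} \<in> nsets V (k - 1)" using x eV by (auto simp: nsets_def)
      have "insert x (e - {x} - {a}) \<in> P \<and> e - {x} - {a} \<notin> C" if a: "a \<in> e - {x}" for a
      proof -
        have 1: "insert x (e - {x} - {a}) = e - {a}" using a x by auto
        have 2: "e - {x} - {a} = e - {x, a}" by auto
        show ?thesis by (subst 1, subst 2) (use neg a in blast)
      qed
      moreover have "x \<in> V - (e - {x})" using x eV(3) by auto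
      ultimately have "x \<in> centres L V P (e - {x})" by (simp add: centres_def C)
      then have "insert x (e - {x}) \<in> stars L V P" using A unfolding stars_def by blast
      then show False using e x by (simp add: insert_absorb)
    qed
    \<comment> \<open>Count the vertices \<open>v\<close> with \<open>e - {v} \<notin> P\<close>:
      none, at least two, or exactly one. In the last case \<open>star\<close> leaves only a crowded
      \<open>e - {x, a}\<close>. The chosen \<open>x\<close> and \<open>y\<close> will get positions
      0 and 1.\<close>
    have ex: "\<exists>x\<in>e. \<exists>y\<in>e. x \<noteq> y \<and> ((\<forall>v\<in>e. e - {v} \<in> P) \<or> (e - {x} \<notin> P \<and> e - {y} \<notin> P)
        \<or> ((\<forall>v\<in>e - {x}. e - {v} \<in> P) \<and> e - {x, y} \<in> C))"
    proof (cases "\<forall>v\<in>e. e - {v} \<in> P")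
      case True
      have "2 \<le> card e" using eV k_ge by simp
      then obtain T where "T \<subseteq> e" "card T = 2" by (rule obtain_subset_with_card_n)
      then obtain x y where "x \<in> e" "y \<in> e" "x \<noteq> y" by (auto simp: card_2_iff)
      then show ?thesis using True by (intro bexI[of _ x] bexI[of _ y]) simp_all
    next
      case False
      then obtain x where x: "x \<in> e" "e - {x} \<notin> P" by auto
      show ?thesis
      proof (cases "\<exists>y\<in>e - {x}. e - {y} \<notin> P")
        case True
        then obtain y where "y \<in> e" "y \<noteq> x" "e - {y} \<notin> P" by auto
        then show ?thesis using x by (intro bexI[of _ x] bexI[of _ y]) simp_all
      next
        case False
        then have rest: "\<forall>v\<in>e - {x}. e - {v} \<in> P" by simp
        obtain a where a: "a \<in> e - {x}" "e - {a} \<notin> P \<or> e - {x, a} \<in> C" using star[OF x(1)] by (elim bexE)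
        then have "e - {x, a} \<in> C" using rest by simp
        then show ?thesis using a(1) rest x(1) by (intro bexI[of _ x] bexI[of _ a]) simp_all
      qed
    qed
    then obtain x y where xy: "x \<in> e" "y \<in> e" "x \<noteq> y" and
      cases: "(\<forall>v\<in>e. e - {v} \<in> P) \<or> (e - {x} \<notin> P \<and> e - {y} \<notin> P)
        \<or> ((\<forall>v\<in>e - {x}. e - {v} \<in> P) \<and> e - {x, y} \<in> C)" by blast
    obtain \<phi> where \<phi>: "bij_betw \<phi> {..<k} e" "\<phi> 0 = x" "\<phi> 1 = y" "\<phi> \<in> extensional {..<k}"
      using ordering_of_edge[OF eV(1,2) xy] by blast
    have inj: "inj_on \<phi> {..<k}" and im: "\<phi> ` {..<k} = e" using \<phi> by (auto simp: bij_betw_def)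
    have "ok e \<phi> i" if i: "i < k" for i
    proof -
      have ie: "\<phi> i \<in> e" using im i by auto
      from cases show ?thesis
      proof (elim disjE conjE)
        assume "\<forall>v\<in>e. e - {v} \<in> P"
        then show ?thesis using ie by (simp add: ok_def)
      next
        assume p: "e - {x} \<notin> P" "e - {y} \<notin> P"
        show ?thesis
        proof (cases "e - {\<phi> i} \<in> P")
          case True
          then show ?thesis by (simp add: ok_def)
        next
          case False
          \<comment> \<open>The vertices at positions 0 and \<open>j\<close> both have a complement
            outside \<open>P\<close>: \<open>x\<close> and \<open>y\<close> by the case at hand,
            \<open>\<phi> i\<close> by assumption.\<close>
          define j where "j = (if i = 0 then 1 else i)"
          have "j \<in> {1..<k}" "i \<in> {0, j}" "{0, j} \<subseteq> {0, 1, i}" using i k_ge by (auto simp: j_def)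
          moreover have "e - {\<phi> 0} \<notin> P" "e - {\<phi> j} \<notin> P" using False p \<phi>(2,3) by (auto simp: j_def)
          ultimately show ?thesis unfolding ok_def by blast
        qed
      next
        assume c: "\<forall>v\<in>e - {x}. e - {v} \<in> P" "e - {x, y} \<in> C"
        show ?thesis
        proof (cases "i = 0")
          case True
          then show ?thesis using c(2) \<phi>(2,3) by (simp add: ok_def)
        next
          case False
          then have "\<phi> i \<noteq> x" using inj i k_ge \<phi>(2) inj_onD[OF inj, of i 0] by auto
          then show ?thesis using c(1) ie by (simp add: ok_def)
        qed
      qed
    qed
    moreover have "\<phi> \<in> {..<k} \<rightarrow>\<^sub>E V" using \<phi>(4) im eV by (auto simp: PiE_def)
    ultimately have "\<phi> \<in> F" using inj im e by (simp add: F_def)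
    then show "e \<in> (\<lambda>\<phi>. \<phi> ` {..<k}) ` F" using im by blast
  qed
  then have le_F: "card (E - stars L V P) \<le> card F"
    using finF by (meson card_image_le card_mono finite_imageI le_trans)

  \<comment> \<open>The first component of a key records why a replacement at the positions \<open>U\<close> can be afforded:
    0, the remaining vertices form one of the few sets in \<open>P\<close>; 1, both \<open>(k - 1)\<close>-sets that omit one
    position of \<open>U\<close> have small degree; 2, the remaining vertices form one of the few crowded sets.\<close>
  define \<Psi> where "\<Psi> U X = {\<psi> \<in> ({..<k} - U) \<rightarrow>\<^sub>E V. \<psi> ` ({..<k} - U) \<in> X}" for U :: "nat set" and X :: "nat set set"
  define K1 where "K1 = (\<Union>i\<in>{..<k}. (\<lambda>\<psi>. (0::nat, {i}, \<psi>)) ` \<Psi> {i} P)"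
  define K2 where "K2 = (\<Union>j\<in>{1..<k}. (\<lambda>\<psi>. (1::nat, {0, j}, \<psi>)) ` \<Psi> {0, j} UNIV)"
  define K3 where "K3 = (\<lambda>\<psi>. (2::nat, {0, 1::nat}, \<psi>)) ` \<Psi> {0, 1} C"
  define K where "K = K1 \<union> (K2 \<union> K3)"
  \<comment> \<open>Under reason 1 the key shows only the common \<open>k - 2\<close> vertices, so
    the class itself must require both \<open>(k - 1)\<close>-sets to lie outside \<open>P\<close>;
    their small degree bounds the slices below.\<close>
  define cls where "cls = (\<lambda>(c, U, \<psi>). {\<phi> \<in> F. restrict \<phi> ({..<k} - U) = \<psi> \<and>
     (c = (1::nat) \<longrightarrow> (\<forall>j\<in>U. \<phi> ` {..<k} - {\<phi> j} \<notin> P))})"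
  \<comment> \<open>Bad means that at most \<open>M\<close> vertices block all replacements at
    \<open>U\<close>; the negation is what \<open>replaceable\<close> asks for.\<close>
  define bad where "bad = (\<lambda>(c::nat, U :: nat set, \<psi> :: nat \<Rightarrow> nat) (S :: (nat \<Rightarrow> nat) set). \<exists>W. finite W \<and> card W \<le> M \<and> (\<forall>\<phi>\<in>S. \<exists>j\<in>U. \<phi> j \<in> W))"
  define t where "t = (\<lambda>(c::nat, U :: nat set, \<psi> :: nat \<Rightarrow> nat). if c = 0 then real M
     else if c = 1 then 2 * real M * r else 2 * real M * real (card V))"

  have fin\<Psi>: "finite (\<Psi> U X)" for U X
    using V by (auto simp: \<Psi>_def intro: finite_subset[OF _ finite_PiE[of "{..<k} - U" "\<lambda>_. V"]])
  have finK: "finite K1" "finite K2" "finite K3" using fin\<Psi> by (auto simp: K1_def K2_def K3_def)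

  \<comment> \<open>Inside a class with two open positions, once the vertex at \<open>i\<close> is
    fixed, the one at \<open>j\<close> determines the ordering.\<close>
  have slice: "card {\<phi> \<in> S. \<phi> i = w} \<le> card ((\<lambda>\<phi>. \<phi> j) ` {\<phi> \<in> S. \<phi> i = w})"
    if "S \<subseteq> F" "\<And>\<phi>. \<phi> \<in> S \<Longrightarrow> restrict \<phi> ({..<k} - {i, j}) = \<psi>" for S \<psi> i j w
  proof -
    have "inj_on (\<lambda>\<phi>. \<phi> j) {\<phi> \<in> S. \<phi> i = w}"
    proof (rule inj_onI)
      fix \<phi> \<phi>' assume a: "\<phi> \<in> {\<phi> \<in> S. \<phi> i = w}" "\<phi>' \<in> {\<phi> \<in> S. \<phi> i = w}" "\<phi> j = \<phi>' j"
      then have res: "restrict \<phi> ({..<k} - {i, j}) = restrict \<phi>' ({..<k} - {i, j})" using that(2) by simp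
      have ext: "\<phi> \<in> extensional {..<k}" "\<phi>' \<in> extensional {..<k}" using a that(1) by (auto simp: F_def PiE_def)
      show "\<phi> = \<phi>'"
      proof (rule extensionalityI[OF ext])
        fix l assume l: "l \<in> {..<k}"
        show "\<phi> l = \<phi>' l"
        proof (cases "l \<in> {i, j}")
          case False
          then show ?thesis using fun_cong[OF res, of l] l by simp
        qed (use a in auto)
      qed
    qed
    then show ?thesis by (simp add: card_image)
  qed

  have "\<exists>F'\<subseteq>F. real (card F) \<le> real (card F') + (\<Sum>\<kappa>\<in>K. t \<kappa>) \<and>
           (\<forall>\<kappa>\<in>K. F' \<inter> cls \<kappa> \<noteq> {} \<longrightarrow> \<not> bad \<kappa> (F' \<inter> cls \<kappa>))"
  proof (rule peeling[OF finF])
    show "finite K" using finK by (simp add: K_def)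
    show "0 \<le> t \<kappa>" for \<kappa> using r by (cases \<kappa>) (auto simp: t_def)
    fix \<kappa> S assume \<kappa>: "\<kappa> \<in> K" and S: "S \<subseteq> F \<inter> cls \<kappa>" and bad: "bad \<kappa> S"
    obtain c U \<psi> where \<kappa>_eq: "\<kappa> = (c, U, \<psi>)" by (cases \<kappa>)
    obtain W where W: "finite W" "card W \<le> M" "\<forall>\<phi>\<in>S. \<exists>j\<in>U. \<phi> j \<in> W" using bad by (auto simp: bad_def \<kappa>_eq)
    have SF: "S \<subseteq> F" and res: "\<And>\<phi>. \<phi> \<in> S \<Longrightarrow> restrict \<phi> ({..<k} - U) = \<psi>" using S by (auto simp: cls_def \<kappa>_eq)
    have finS: "finite S" using SF finF finite_subset by blast
    from \<kappa> consider "\<kappa> \<in> K1" | "\<kappa> \<in> K2" | "\<kappa> \<in> K3" by (auto simp: K_def)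
    then show "real (card S) \<le> t \<kappa>"
    proof cases
      case 1
      then obtain i where i: "c = 0" "U = {i}" "i < k" by (auto simp: K1_def \<kappa>_eq)
      have hitW: "\<phi> i \<in> W" if "\<phi> \<in> S" for \<phi> using W(3) i that by auto
      have "inj_on (\<lambda>\<phi>. \<phi> i) S"
      proof (rule inj_onI)
        fix \<phi> \<phi>' assume a: "\<phi> \<in> S" "\<phi>' \<in> S" "\<phi> i = \<phi>' i"
        then have res': "restrict \<phi> ({..<k} - {i}) = restrict \<phi>' ({..<k} - {i})" using res i by simp
        have ext: "\<phi> \<in> extensional {..<k}" "\<phi>' \<in> extensional {..<k}" using a SF by (auto simp: F_def PiE_def)
        show "\<phi> = \<phi>'"
        proof (rule extensionalityI[OF ext])
          fix l assume l: "l \<in> {..<k}"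
          show "\<phi> l = \<phi>' l"
            using fun_cong[OF res', of l] l a by (cases "l = i") auto
        qed
      qed
      then have "card S \<le> card W" using hitW W(1) by (intro card_inj_on_le[of "\<lambda>\<phi>. \<phi> i"]) auto
      then show ?thesis using W(2) i by (simp add: t_def \<kappa>_eq)
    next
      case 2
      then obtain j where j: "c = 1" "U = {0, j}" "1 \<le> j" "j < k" by (auto simp: K2_def \<kappa>_eq)
      have poor: "\<phi> ` {..<k} - {\<phi> l} \<notin> P" if "\<phi> \<in> S" "l \<in> {0, j}" for \<phi> l
        using that S j by (auto simp: cls_def \<kappa>_eq)
      \<comment> \<open>Fixing the vertex at \<open>a\<close> fixes the \<open>(k - 1)\<close>-set
        \<open>p\<close> that omits position \<open>b\<close>; it is not in \<open>P\<close>, so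
        fewer than \<open>r\<close> edges contain it.\<close>
      have sl: "real (card {\<phi> \<in> S. \<phi> a = w}) \<le> r" if ab: "(a = 0 \<and> b = j) \<or> (a = j \<and> b = 0)" for a b w
      proof (cases "{\<phi> \<in> S. \<phi> a = w} = {}")
        case False
        then obtain \<phi>0 where \<phi>0: "\<phi>0 \<in> S" "\<phi>0 a = w" by auto
        define p where "p = \<phi>0 ` ({..<k} - {b})"
        have ab2: "{a, b} = {0, j}" "a < k" "b < k" "a \<noteq> b" using ab j by auto
        have p_all: "\<phi> ` ({..<k} - {b}) = p" if "\<phi> \<in> S" "\<phi> a = w" for \<phi>
        proof -
          have "\<phi> l = \<phi>0 l" if l: "l \<in> {..<k} - {b}" for l
          proof (cases "l = a")
            case False
            have "restrict \<phi> ({..<k} - U) = restrict \<phi>0 ({..<k} - U)" using res \<phi>0 \<open>\<phi> \<in> S\<close> by simp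
            moreover have "l \<in> {..<k} - U" using l False ab2(1) j(2) by blast
            ultimately show ?thesis by (metis restrict_apply')
          qed (use \<phi>0 \<open>\<phi> a = w\<close> in simp)
          then show ?thesis by (simp add: p_def)
        qed
        have pd: "p = \<phi>0 ` {..<k} - {\<phi>0 b}" using diff[of \<phi>0 "{b}"] \<phi>0(1) SF ab2(3) unfolding p_def by blast
        have \<phi>0E: "\<phi>0 ` {..<k} \<in> E" "inj_on \<phi>0 {..<k}" using \<phi>0 SF by (auto simp: F_def)
        then have "card (\<phi>0 ` {..<k}) = k" "\<phi>0 ` {..<k} \<subseteq> V" using E by (auto simp: nsets_def)
        moreover have "\<phi>0 b \<in> \<phi>0 ` {..<k}" using ab2(3) by simp
        ultimately have "p \<in> nsets V (k - 1)" unfolding pd nsets_def by auto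
        moreover have "b \<in> {0, j}" using ab2(1) by blast
        then have "p \<notin> P" using poor[OF \<phi>0(1)] pd by simp
        ultimately have low: "real (card {e \<in> E. p \<subseteq> e}) < r" by (simp add: P rich_def not_le)
        have new: "\<phi> b \<notin> p \<and> insert (\<phi> b) p \<in> E" if "\<phi> \<in> S" "\<phi> a = w" for \<phi>
        proof -
          have "p = \<phi> ` {..<k} - {\<phi> b}" using p_all[OF that] diff[of \<phi> "{b}"] that(1) SF ab2(3) by blast
          moreover have "\<phi> b \<in> \<phi> ` {..<k}" using ab2(3) by simp
          ultimately have "\<phi> b \<notin> p" "insert (\<phi> b) p = \<phi> ` {..<k}" by auto
          then show ?thesis using that SF by (auto simp: F_def)
        qed
        have "finite E" using E V finite_imp_finite_nsets finite_subset by metis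
        then have "card ((\<lambda>\<phi>. \<phi> b) ` {\<phi> \<in> S. \<phi> a = w}) \<le> card {e \<in> E. p \<subseteq> e}"
          using card_insert_le_supersets[of E "(\<lambda>\<phi>. \<phi> b) ` {\<phi> \<in> S. \<phi> a = w}" p] new by auto
        moreover have "card {\<phi> \<in> S. \<phi> a = w} \<le> card ((\<lambda>\<phi>. \<phi> b) ` {\<phi> \<in> S. \<phi> a = w})"
          by (rule slice[OF SF]) (use res j ab2 in auto)
        ultimately show ?thesis using low by linarith
      next
        case True
        show ?thesis unfolding True using r by simp
      qed
      have "real (card S) \<le> 2 * real M * r"
      proof (rule card_le_slices[OF W(1,2) _ finS r])
        show "\<phi> 0 \<in> W \<or> \<phi> j \<in> W" if "\<phi> \<in> S" for \<phi> using W(3) that j by auto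
        show "real (card {\<phi> \<in> S. \<phi> 0 = w}) \<le> r" for w by (rule sl[of 0 j]) simp
        show "real (card {\<phi> \<in> S. \<phi> j = w}) \<le> r" for w by (rule sl[of j 0]) simp
      qed
      then show ?thesis using j by (simp add: t_def \<kappa>_eq)
    next
      case 3
      then have j: "c = 2" "U = {0, 1}" by (auto simp: K3_def \<kappa>_eq)
      have sl: "real (card {\<phi> \<in> S. \<phi> a = w}) \<le> real (card V)" if ab: "(a = 0 \<and> b = 1) \<or> (a = 1 \<and> b = 0)" for a b w :: nat
      proof -
        have ab2: "{a, b} = {0, 1}" "b < k" using ab k_ge by auto
        have "card {\<phi> \<in> S. \<phi> a = w} \<le> card ((\<lambda>\<phi>. \<phi> b) ` {\<phi> \<in> S. \<phi> a = w})"
          by (rule slice[OF SF]) (use res j ab2 in auto)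
        also have "\<dots> \<le> card V" using V SF ab2 by (intro card_mono) (auto simp: F_def)
        finally show ?thesis by simp
      qed
      have "real (card S) \<le> 2 * real M * real (card V)"
      proof (rule card_le_slices[OF W(1,2) _ finS])
        show "\<phi> 0 \<in> W \<or> \<phi> 1 \<in> W" if "\<phi> \<in> S" for \<phi> using W(3) that j by auto
        show "real (card {\<phi> \<in> S. \<phi> 0 = w}) \<le> real (card V)" for w by (rule sl[of 0 1]) simp
        show "real (card {\<phi> \<in> S. \<phi> 1 = w}) \<le> real (card V)" for w by (rule sl[of 1 0]) simp
      qed simp
      then show ?thesis using j by (simp add: t_def \<kappa>_eq)
    qed
  qed
  then obtain F' where F': "F' \<subseteq> F" "real (card F) \<le> real (card F') + (\<Sum>\<kappa>\<in>K. t \<kappa>)"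
    "\<forall>\<kappa>\<in>K. F' \<inter> cls \<kappa> \<noteq> {} \<longrightarrow> \<not> bad \<kappa> (F' \<inter> cls \<kappa>)" by blast

  \<comment> \<open>An ordering in \<open>F'\<close> belongs to the class of a key that justifies
    position \<open>i\<close>. This class meets \<open>F'\<close>, hence is not bad there, and so
    contains an ordering in \<open>F'\<close> that avoids \<open>W\<close> on
    \<open>U\<close>.\<close>
  have "replaceable k M F'"
    unfolding replaceable_def
  proof (intro ballI allI impI)
    fix \<phi> i and W :: "nat set" assume \<phi>: "\<phi> \<in> F'" and i: "i < k" and W: "finite W" "card W \<le> M"
    define e where "e = \<phi> ` {..<k}"
    have \<phi>F: "\<phi> \<in> F" using \<phi> F' by auto
    then have ok: "ok e \<phi> i" using i by (auto simp: F_def e_def)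
    have \<phi>V: "restrict \<phi> ({..<k} - U) \<in> ({..<k} - U) \<rightarrow>\<^sub>E V" for U using \<phi>F by (auto simp: F_def)
    have im: "restrict \<phi> ({..<k} - U) ` ({..<k} - U) = e - \<phi> ` U" if "U \<subseteq> {..<k}" for U
      using diff[OF \<phi>F that] by (simp add: e_def)
    have "\<exists>c U. i \<in> U \<and> U \<subseteq> {0, 1, i} \<and> (c, U, restrict \<phi> ({..<k} - U)) \<in> K \<and>
        \<phi> \<in> cls (c, U, restrict \<phi> ({..<k} - U))"
      using ok unfolding ok_def
    proof (elim disjE bexE conjE)
      assume a: "e - {\<phi> i} \<in> P"
      have "restrict \<phi> ({..<k} - {i}) \<in> \<Psi> {i} P" using a \<phi>V[of "{i}"] im[of "{i}"] i by (simp add: \<Psi>_def)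
      then have "(0, {i}, restrict \<phi> ({..<k} - {i})) \<in> K" using i by (auto simp: K_def K1_def)
      moreover have "\<phi> \<in> cls (0, {i}, restrict \<phi> ({..<k} - {i}))" using \<phi>F by (simp add: cls_def)
      ultimately show ?thesis by blast
    next
      fix j assume j: "j \<in> {1..<k}" "i \<in> {0, j}" "{0, j} \<subseteq> {0, 1, i}" "e - {\<phi> 0} \<notin> P" "e - {\<phi> j} \<notin> P"
      have "restrict \<phi> ({..<k} - {0, j}) \<in> \<Psi> {0, j} UNIV" using \<phi>V[of "{0, j}"] by (simp add: \<Psi>_def)
      then have "(1, {0, j}, restrict \<phi> ({..<k} - {0, j})) \<in> K" using j by (auto simp: K_def K2_def)
      moreover have "\<phi> \<in> cls (1, {0, j}, restrict \<phi> ({..<k} - {0, j}))" using \<phi>F j(4,5) by (auto simp: cls_def e_def)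
      ultimately show ?thesis using j by blast
    next
      assume a: "i < 2" "e - {\<phi> 0, \<phi> 1} \<in> C"
      have "restrict \<phi> ({..<k} - {0, 1}) \<in> \<Psi> {0, 1} C" using a \<phi>V[of "{0, 1}"] im[of "{0, 1}"] k_ge by (simp add: \<Psi>_def)
      then have "(2, {0, 1}, restrict \<phi> ({..<k} - {0, 1})) \<in> K" by (auto simp: K_def K3_def)
      moreover have "\<phi> \<in> cls (2, {0, 1}, restrict \<phi> ({..<k} - {0, 1}))" using \<phi>F by (simp add: cls_def)
      moreover have "i \<in> {0, 1}" using a by auto
      ultimately show ?thesis by blast
    qed
    then obtain c U where U: "i \<in> U" "U \<subseteq> {0, 1, i}" "(c, U, restrict \<phi> ({..<k} - U)) \<in> K"
        "\<phi> \<in> cls (c, U, restrict \<phi> ({..<k} - U))" by blast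
    then have "\<not> bad (c, U, restrict \<phi> ({..<k} - U)) (F' \<inter> cls (c, U, restrict \<phi> ({..<k} - U)))"
      using F'(3) \<phi> by blast
    then obtain \<psi> where \<psi>: "\<psi> \<in> F'" "\<psi> \<in> cls (c, U, restrict \<phi> ({..<k} - U))" "\<forall>j\<in>U. \<psi> j \<notin> W"
      using W by (auto simp: bad_def)
    have "\<psi> j = \<phi> j" if "j \<in> {..<k} - U" for j
    proof -
      have "restrict \<psi> ({..<k} - U) = restrict \<phi> ({..<k} - U)" using \<psi>(2) by (simp add: cls_def)
      from fun_cong[OF this, of j] show ?thesis using that by simp
    qed
    then show "\<exists>U. \<exists>\<psi>\<in>F'. i \<in> U \<and> U \<subseteq> {0, 1, i} \<and> (\<forall>j\<in>{..<k} - U. \<psi> j = \<phi> j) \<and> (\<forall>j\<in>U. \<psi> j \<notin> W)"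
      using U \<psi> by blast
  qed
  moreover have "inj_on \<phi> {..<k} \<and> \<phi> ` {..<k} \<in> E" if "\<phi> \<in> F'" for \<phi>
    using that F'(1) by (auto simp: F_def)
  ultimately have "F' = {}" using copy_of_replaceable[OF _ _ _ E] free by blast
  then have "real (card F) \<le> (\<Sum>\<kappa>\<in>K. t \<kappa>)" using F'(2) by simp
  also have "\<dots> = (\<Sum>\<kappa>\<in>K1. t \<kappa>) + ((\<Sum>\<kappa>\<in>K2. t \<kappa>) + (\<Sum>\<kappa>\<in>K3. t \<kappa>))"
  proof -
    have "(\<Sum>\<kappa>\<in>K2 \<union> K3. t \<kappa>) = (\<Sum>\<kappa>\<in>K2. t \<kappa>) + (\<Sum>\<kappa>\<in>K3. t \<kappa>)"
      using finK by (intro sum.union_disjoint) (auto simp: K2_def K3_def)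
    moreover have "(\<Sum>\<kappa>\<in>K. t \<kappa>) = (\<Sum>\<kappa>\<in>K1. t \<kappa>) + (\<Sum>\<kappa>\<in>K2 \<union> K3. t \<kappa>)"
      unfolding K_def using finK by (intro sum.union_disjoint) (auto simp: K1_def K2_def K3_def)
    ultimately show ?thesis by simp
  qed
  also have "(\<Sum>\<kappa>\<in>K1. t \<kappa>) = real (card K1) * real M"
  proof -
    have "(\<Sum>\<kappa>\<in>K1. t \<kappa>) = (\<Sum>\<kappa>\<in>K1. real M)" by (rule sum.cong) (auto simp: K1_def t_def)
    then show ?thesis by simp
  qed
  also have "(\<Sum>\<kappa>\<in>K2. t \<kappa>) = real (card K2) * (2 * real M * r)"
  proof -
    have "(\<Sum>\<kappa>\<in>K2. t \<kappa>) = (\<Sum>\<kappa>\<in>K2. 2 * real M * r)" by (rule sum.cong) (auto simp: K2_def t_def)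
    then show ?thesis by simp
  qed
  also have "(\<Sum>\<kappa>\<in>K3. t \<kappa>) = real (card K3) * (2 * real M * real (card V))"
  proof -
    have "(\<Sum>\<kappa>\<in>K3. t \<kappa>) = (\<Sum>\<kappa>\<in>K3. 2 * real M * real (card V))" by (rule sum.cong) (auto simp: K3_def t_def)
    then show ?thesis by simp
  qed
  finally have F_le: "real (card F) \<le> real (card K1) * real M +
    (real (card K2) * (2 * real M * r) + real (card K3) * (2 * real M * real (card V)))" .
  \<comment> \<open>A member of \<open>X\<close> is the image of at most \<open>k ^ k\<close> of
    these functions.\<close>
  have card_key: "card (\<Psi> U X) \<le> card X * k ^ k"
    if "X \<subseteq> nsets V m" "finite X" "m \<le> k" for U X m
  proof -
    have "card (\<Psi> U X) \<le> card X * k ^ card ({..<k} - U)"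
      unfolding \<Psi>_def using that by (intro card_PiE_image_le) (auto simp: nsets_def)
    also have "\<dots> \<le> card X * k ^ k"
      using k_ge card_mono[of "{..<k}" "{..<k} - U"] by (intro mult_left_mono power_increasing) auto
    finally show ?thesis .
  qed
  have "card K1 \<le> (\<Sum>i<k. card ((\<lambda>\<psi>. (0::nat, {i}, \<psi>)) ` \<Psi> {i} P))"
    unfolding K1_def by (rule card_UN_le) simp
  also have "\<dots> \<le> (\<Sum>i<k. card P * k ^ k)"
    using card_key[OF PV finPC(1)] fin\<Psi> by (intro sum_mono order_trans[OF card_image_le]) auto
  finally have k1: "card K1 \<le> k * (card P * k ^ k)" by simp
  have "card K2 \<le> (\<Sum>j\<in>{1..<k}. card ((\<lambda>\<psi>. (1::nat, {0, j}, \<psi>)) ` \<Psi> {0, j} UNIV))"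
    unfolding K2_def by (rule card_UN_le) simp
  also have "\<dots> \<le> (\<Sum>j\<in>{1..<k}. card V ^ (k - 2))"
  proof (intro sum_mono order_trans[OF card_image_le] fin\<Psi>)
    fix j assume "j \<in> {1..<k}"
    then have "card ({..<k} - {0, j}) = k - 2" by (subst card_Diff_subset) auto
    then show "card (\<Psi> {0, j} UNIV) \<le> card V ^ (k - 2)" by (simp add: \<Psi>_def card_PiE)
  qed
  also have "\<dots> \<le> k * card V ^ (k - 2)" by simp
  finally have k2: "card K2 \<le> k * card V ^ (k - 2)" .
  have "card K3 \<le> card (\<Psi> {0, 1} C)" unfolding K3_def by (rule card_image_le[OF fin\<Psi>])
  also have "\<dots> \<le> card C * k ^ k" by (rule card_key[OF CV finPC(2)]) simp
  finally have k3: "card K3 \<le> card C * k ^ k" .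
  have "real (card K1) * real M \<le> real (k * (card P * k ^ k)) * real M"
    using k1 by (intro mult_right_mono of_nat_mono) auto
  moreover have "real (card K2) * (2 * real M * r) \<le> real (k * card V ^ (k - 2)) * (2 * real M * r)"
    using k2 r by (intro mult_right_mono of_nat_mono) auto
  moreover have "real (card K3) * (2 * real M * real (card V)) \<le> real (card C * k ^ k) * (2 * real M * real (card V))"
    using k3 by (intro mult_right_mono of_nat_mono) auto
  moreover have "real (card (E - stars L V P)) \<le> real (card F)" using le_F by simp
  ultimately show ?thesis using F_le by linarith
qed

section \<open>Cross-cuts and sets with many centres\<close>

text \<open>One degree-one vertex from each edge works, as such a vertex lies in no other edge.
  Hence the \<open>LEAST\<close> in \<open>cross_cut_number\<close> is attained.\<close>

lemma cross_cut_exists: "\<exists>S. cross_cut H S \<and> finite S"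
proof -
  define c where "c e = (SOME v. v \<in> e \<inter> leaves)" for e
  have c: "c e \<in> e \<inter> leaves" if "e \<in> edges H" for e
  proof -
    have "e \<inter> leaves \<noteq> {}" using leaves_in_edge[OF that] by auto
    then show ?thesis unfolding c_def by (metis some_in_eq)
  qed
  have "e \<inter> c ` edges H = {c e}" if e: "e \<in> edges H" for e
  proof -
    have "c e' = c e" if "e' \<in> edges H" "c e' \<in> e" for e'
      using c[OF that(1)] leaves_unique_edge[OF e that(1)] that(2) by (cases "e = e'") auto
    then have "e \<inter> c ` edges H \<subseteq> {c e}" by blast
    moreover have "c e \<in> e \<inter> c ` edges H" using c[OF e] e by blast
    ultimately show ?thesis by blast
  qed
  then have "card (e \<inter> c ` edges H) = 1" if "e \<in> edges H" for e using that by simp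
  moreover have "c ` edges H \<subseteq> verts H" unfolding verts_eq using c by blast
  ultimately have "cross_cut H (c ` edges H)" by (simp add: cross_cut_def)
  then show ?thesis using finite_edges by blast
qed

lemma minimal_cross_cut:
  obtains S where "cross_cut H S" "finite S" "card S = cross_cut_number H"
proof -
  have "\<exists>s S. cross_cut H S \<and> finite S \<and> card S = s" using cross_cut_exists by blast
  from LeastI_ex[OF this] show ?thesis using that unfolding cross_cut_number_def by blast
qed

lemma cross_cut_number_le: "cross_cut H S \<Longrightarrow> finite S \<Longrightarrow> cross_cut_number H \<le> card S"
  unfolding cross_cut_number_def by (rule Least_le) blast

lemma cross_cut_number_pos: "0 < cross_cut_number H"
proof -
  obtain S where S: "cross_cut H S" "finite S" "card S = cross_cut_number H" by (rule minimal_cross_cut)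
  obtain e where "e \<in> edges H" using edges_nonempty by auto
  then have "card (e \<inter> S) = 1" using S by (auto simp: cross_cut_def)
  then have "S \<noteq> {}" by auto
  then show ?thesis using S by (metis card_gt_0_iff)
qed

text \<open>Choose a set \<open>\<chi> A\<close> of \<open>cross_cut_number H\<close> centres for
  each such \<open>A\<close> and peel over pairs \<open>(B, X)\<close> with
  \<open>B \<subseteq> A\<close> and \<open>X = \<chi> A\<close>, at cost \<open>M\<close> each. A
  survivor would yield a family of sets with the same centres \<open>X\<close> in which every
  element can be exchanged, and a minimum cross-cut mapped onto \<open>X\<close> would extend to a
  copy of \<open>H\<close>.\<close>

lemma card_many_centres:
  assumes V: "finite V" and E: "E \<subseteq> nsets V k" and free: "\<not> contains_copy (V, E) H"
    and r: "real M < r" and P: "P = rich r V E"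
  shows "card {A \<in> nsets V (k - 1). cross_cut_number H \<le> card (centres L V P A)} \<le> M * 2 ^ L * card V ^ (k - 2)"
proof -
  obtain S where S: "cross_cut H S" "finite S" "card S = cross_cut_number H" by (rule minimal_cross_cut)
  define F where "F = {A \<in> nsets V (k - 1). cross_cut_number H \<le> card (centres L V P A)}"
  have PV: "P \<subseteq> nsets V (k - 1)" by (auto simp: P rich_def)
  have finP: "finite P" using PV V finite_imp_finite_nsets finite_subset by metis
  have finF: "finite F" using V by (auto simp: F_def finite_imp_finite_nsets)
  have "\<forall>A\<in>F. \<exists>X. X \<subseteq> centres L V P A \<and> card X = cross_cut_number H"
    by (auto simp: F_def intro: obtain_subset_with_card_n)
  then obtain \<chi> where \<chi>: "\<And>A. A \<in> F \<Longrightarrow> \<chi> A \<subseteq> centres L V P A" "\<And>A. A \<in> F \<Longrightarrow> card (\<chi> A) = cross_cut_number H"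
    by metis
  \<comment> \<open>As \<open>B\<close> is not crowded, at most \<open>L\<close> vertices extend it
    within \<open>P\<close>, which leaves at most \<open>2 ^ L\<close> sets
    \<open>X\<close>.\<close>
  define K where "K = Sigma (nsets V (k - 2) - crowded L V P) (\<lambda>B. Pow {x. x \<notin> B \<and> insert x B \<in> P})"
  define cls where "cls = (\<lambda>(B, X). {A \<in> F. B \<subseteq> A \<and> \<chi> A = X})"
  define bad where "bad = (\<lambda>(B :: nat set, X :: nat set) T. \<exists>W. finite W \<and> card W \<le> M \<and> (\<forall>A\<in>T. (A - B) \<inter> W \<noteq> {}))"
  have nbrs: "finite {x. x \<notin> B \<and> insert x B \<in> P} \<and> card {x. x \<notin> B \<and> insert x B \<in> P} \<le> L"
    if "B \<in> nsets V (k - 2) - crowded L V P" for B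
    using card_insert_le_supersets[OF finP subset_refl, of B] that by (auto simp: crowded_def)
  have finK: "finite K" unfolding K_def using V nbrs by (intro finite_SigmaI) (auto simp: finite_imp_finite_nsets)
  have "\<exists>F'\<subseteq>F. real (card F) \<le> real (card F') + (\<Sum>\<kappa>\<in>K. real M) \<and>
           (\<forall>\<kappa>\<in>K. F' \<inter> cls \<kappa> \<noteq> {} \<longrightarrow> \<not> bad \<kappa> (F' \<inter> cls \<kappa>))"
  proof (rule peeling[OF finF finK])
    fix \<kappa> T assume \<kappa>: "\<kappa> \<in> K" and T: "T \<subseteq> F \<inter> cls \<kappa>" and bad: "bad \<kappa> T"
    obtain B X where \<kappa>_eq: "\<kappa> = (B, X)" by (cases \<kappa>)
    obtain W where W: "finite W" "card W \<le> M" "\<forall>A\<in>T. (A - B) \<inter> W \<noteq> {}" using bad by (auto simp: bad_def \<kappa>_eq)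
    have B: "card B = k - 2" "finite B" using \<kappa> by (auto simp: K_def \<kappa>_eq nsets_def)
    have "T \<subseteq> (\<lambda>w. insert w B) ` W"
    proof
      fix A assume A: "A \<in> T"
      then have "B \<subseteq> A" "finite A" "card A = k - 1" using T by (auto simp: cls_def \<kappa>_eq F_def nsets_def)
      then have "card (A - B) = 1" using B k_ge by (simp add: card_Diff_subset)
      then obtain w where "A - B = {w}" by (auto simp: card_1_singleton_iff)
      moreover from this have "w \<in> W" using W(3) A by auto
      ultimately show "A \<in> (\<lambda>w. insert w B) ` W" using \<open>B \<subseteq> A\<close> by auto
    qed
    then have "card T \<le> card W" using W(1) by (meson card_image_le card_mono finite_imageI le_trans)
    then show "real (card T) \<le> real M" using W(2) by simp
  qed simp
  then obtain F' where F': "F' \<subseteq> F" "real (card F) \<le> real (card F') + real (card K) * real M"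
    "\<forall>\<kappa>\<in>K. F' \<inter> cls \<kappa> \<noteq> {} \<longrightarrow> \<not> bad \<kappa> (F' \<inter> cls \<kappa>)" by auto
  have "F' = {}"
  proof (rule ccontr)
    assume "F' \<noteq> {}"
    then obtain A0 where A0: "A0 \<in> F'" by auto
    define X where "X = \<chi> A0"
    define Q where "Q = {A \<in> F'. \<chi> A = X}"
    define R where "R = {A - {a} |A a. A \<in> Q \<and> a \<in> A}"
    have QF: "A \<in> F" "\<chi> A = X" "A \<in> F'" if "A \<in> Q" for A using that F' by (auto simp: Q_def)
    have Qset: "finite A" "card A = k - 1" "A \<subseteq> V" if "A \<in> Q" for A
      using QF(1)[OF that] by (auto simp: F_def nsets_def)
    have Xc: "x \<notin> A \<and> (\<forall>a\<in>A. insert x (A - {a}) \<in> P \<and> A - {a} \<notin> crowded L V P)" if "A \<in> Q" "x \<in> X" for A x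
      using \<chi>(1)[OF QF(1)[OF that(1)]] QF(2)[OF that(1)] that(2) by (auto simp: centres_def)
    have "card X = card S" using \<chi>(2)[of A0] A0 F' S(3) by (auto simp: X_def)
    moreover have "X \<subseteq> V" using \<chi>(1)[of A0] A0 F'(1) by (auto simp: X_def centres_def)
    then have "finite X" using V finite_subset by blast
    ultimately obtain g where g: "bij_betw g S X" using S(2) by (metis finite_same_card_bij)
    have sne: "X \<noteq> {}" using \<open>card X = card S\<close> S(3) cross_cut_number_pos by auto
    \<comment> \<open>\<open>A\<close> lies in the class of the key \<open>(A - {a}, X)\<close>,
      which is therefore not bad and contains a set whose vertex outside \<open>A - {a}\<close>
      avoids \<open>W\<close>.\<close>
    have Qswap: "\<exists>z. z \<notin> W \<and> insert z (A - {a}) \<in> Q" if A: "A \<in> Q" "a \<in> A" and W: "finite W" "card W \<le> M" for A a W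
    proof -
      have "A - {a} \<in> nsets V (k - 2)" using Qset[OF A(1)] A(2) by (auto simp: nsets_def)
      moreover have "A - {a} \<notin> crowded L V P" using Xc[OF A(1)] A(2) sne by blast
      moreover have "X \<subseteq> {x. x \<notin> A - {a} \<and> insert x (A - {a}) \<in> P}" using Xc[OF A(1)] A(2) by blast
      ultimately have "(A - {a}, X) \<in> K" by (simp add: K_def)
      moreover have "A \<in> F' \<inter> cls (A - {a}, X)" using QF[OF A(1)] by (auto simp: cls_def)
      ultimately have "\<not> bad (A - {a}, X) (F' \<inter> cls (A - {a}, X))" using F'(3) by blast
      then obtain A2 where A2: "A2 \<in> F'" "A2 \<in> cls (A - {a}, X)" "(A2 - (A - {a})) \<inter> W = {}"
        using W by (auto simp: bad_def)
      then have A2Q: "A2 \<in> Q" "A - {a} \<subseteq> A2" by (auto simp: Q_def cls_def)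
      then have "card (A2 - (A - {a})) = 1"
        using Qset[OF A(1)] Qset[OF A2Q(1)] A(2) k_ge by (simp add: card_Diff_subset)
      then obtain z where z: "A2 - (A - {a}) = {z}" by (auto simp: card_1_singleton_iff)
      then have "insert z (A - {a}) = A2" using A2Q by auto
      then show ?thesis using A2Q A2 z by auto
    qed
    \<comment> \<open>An edge has at least two degree-one vertices and only one vertex in
      \<open>S\<close>, so a degree-one vertex off \<open>S\<close> exists.\<close>
    define d where "d e = (SOME v. v \<in> e \<inter> leaves - S)" for e
    have d: "d e \<in> e \<inter> leaves - S" if "e \<in> edges H" for e
    proof -
      have "card (e \<inter> S) = 1" using S(1) that by (auto simp: cross_cut_def)
      have "e \<inter> leaves - S \<noteq> {}"
      proof
        assume "e \<inter> leaves - S = {}"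
        then have "e \<inter> leaves \<subseteq> e \<inter> S" by auto
        then have "card (e \<inter> leaves) \<le> card (e \<inter> S)" using S(2) by (intro card_mono) auto
        then show False using leaves_in_edge[OF that] \<open>card (e \<inter> S) = 1\<close> by simp
      qed
      then show ?thesis unfolding d_def by (metis some_in_eq)
    qed
    have "\<exists>f. inj_on f (verts H \<union> S) \<and> (\<forall>s\<in>S. f s = g s) \<and> (\<forall>e\<in>edges H. f ` e \<in> E \<and> f ` (e - S - {d e}) \<in> R)"
    proof (rule embed_along_cross_cut[where k=k and M=M])
      show "hypertree H" by (rule hyper)
      show "finite e \<and> card e = k" if "e \<in> edges H" for e by (rule edge_card[OF that])
      show "card (e \<inter> S) = 1" if "e \<in> edges H" for e using that S(1) by (auto simp: cross_cut_def)
      show "d e \<in> e - S" if "e \<in> edges H" for e using d[OF that] by auto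
      show "d e \<notin> e'" if "e \<in> edges H" "e' \<in> edges H" "e \<noteq> e'" for e e'
        using d[OF that(1)] leaves_unique_edge[OF that] by auto
      have "verts H \<union> S = verts H" using S(1) by (auto simp: cross_cut_def)
      then show "card (verts H \<union> S) \<le> M" by (simp add: M_def)
      show "finite S" by (rule S(2))
      show "inj_on g S" using g by (auto simp: bij_betw_def)
      have "A0 \<in> Q" using A0 by (simp add: Q_def X_def)
      moreover from Qset[OF this] have "A0 \<noteq> {}" using k_ge by auto
      ultimately show "R \<noteq> {}" by (auto simp: R_def)
      show Rc: "finite B \<and> card B = k - 2" if B: "B \<in> R" for B
      proof -
        obtain A a where "A \<in> Q" "a \<in> A" "B = A - {a}" using B by (auto simp: R_def)
        then show ?thesis using Qset[of A] by simp
      qed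
      show "\<exists>B'\<in>R. I \<subseteq> B' \<and> (B' - I) \<inter> W = {}" if "B \<in> R" "I \<subseteq> B" "finite W" "card W \<le> M" for B I W
        by (rule swap_shadow[OF Qswap R_def that(1) _ that(2-4)]) (use Rc[OF that(1)] in auto)
      show "\<exists>z. z \<notin> W \<and> insert z (insert (g s) B) \<in> E"
        if B: "B \<in> R" and s: "s \<in> S" and W: "finite W" "card W \<le> M" for B s W
      proof -
        obtain A a where A: "A \<in> Q" "a \<in> A" "B = A - {a}" using B by (auto simp: R_def)
        have gs: "g s \<in> X" using g s by (auto simp: bij_betw_def)
        \<comment> \<open>\<open>p\<close> is rich, so more than \<open>M\<close> edges extend it by
          one vertex, and one of these vertices is outside \<open>W\<close>.\<close>
        define p where "p = insert (g s) B"
        have "p \<in> P" using Xc[OF A(1) gs] A by (auto simp: p_def)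
        then have "M < card {e \<in> E. p \<subseteq> e}" "p \<in> nsets V (k - 1)" using r by (auto simp: P rich_def)
        have "\<exists>e\<in>{e \<in> E. p \<subseteq> e}. (e - p) \<inter> W = {}"
        proof (rule ccontr)
          assume neg: "\<not> ?thesis"
          have "{e \<in> E. p \<subseteq> e} \<subseteq> (\<lambda>w. insert w p) ` W"
          proof
            fix e assume e: "e \<in> {e \<in> E. p \<subseteq> e}"
            then have "card e = k" "finite e" using E by (auto simp: nsets_def)
            then have "card (e - p) = 1" using e \<open>p \<in> nsets V (k - 1)\<close> k_ge
              by (simp add: card_Diff_subset nsets_def)
            then obtain w where w: "e - p = {w}" by (auto simp: card_1_singleton_iff)
            then have "w \<in> W" using neg e by auto
            moreover have "e = insert w p" using w e by auto
            ultimately show "e \<in> (\<lambda>w. insert w p) ` W" by blast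
          qed
          then have "card {e \<in> E. p \<subseteq> e} \<le> card W" using W(1) by (meson card_image_le card_mono finite_imageI le_trans)
          then show False using \<open>M < card {e \<in> E. p \<subseteq> e}\<close> W(2) by simp
        qed
        then obtain e where e: "e \<in> E" "p \<subseteq> e" "(e - p) \<inter> W = {}" by blast
        then have "card e = k" "finite e" using E by (auto simp: nsets_def)
        then have "card (e - p) = 1" using e \<open>p \<in> nsets V (k - 1)\<close> k_ge
          by (simp add: card_Diff_subset nsets_def)
        then obtain z where z: "e - p = {z}" by (auto simp: card_1_singleton_iff)
        then have "insert z p = e" using e by auto
        then show ?thesis using e z by (auto simp: p_def)
      qed
    qed
    then obtain f where f: "inj_on f (verts H \<union> S)" "\<forall>e\<in>edges H. f ` e \<in> E" by blast
    then have "contains_copy (V, E) H"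
      using contains_copyI[OF _ verts_eq E, of f] by (meson inj_on_subset sup_ge1)
    then show False using free by simp
  qed
  then have "real (card F) \<le> real (card K * M)" using F'(2) by simp
  then have "card F \<le> card K * M" by (simp only: of_nat_le_iff)
  also have "card K \<le> 2 ^ L * card V ^ (k - 2)"
  proof -
    have "card K = (\<Sum>B\<in>nsets V (k - 2) - crowded L V P. card (Pow {x. x \<notin> B \<and> insert x B \<in> P}))"
      unfolding K_def using V nbrs by (subst card_SigmaI) (auto simp: finite_imp_finite_nsets)
    also have "\<dots> \<le> (\<Sum>B\<in>nsets V (k - 2) - crowded L V P. 2 ^ L)"
      using nbrs by (intro sum_mono) (simp add: card_Pow power_increasing)
    also have "\<dots> = card (nsets V (k - 2) - crowded L V P) * 2 ^ L" by simp
    also have "\<dots> \<le> card (nsets V (k - 2)) * 2 ^ L"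
      using V by (intro mult_right_mono card_mono) (auto simp: finite_imp_finite_nsets)
    also have "\<dots> \<le> card V ^ (k - 2) * 2 ^ L"
      using card_nsets_le_power[OF V] by (intro mult_right_mono) auto
    finally show ?thesis by (simp add: mult.commute)
  qed
  finally show ?thesis by (simp add: F_def mult_ac)
qed

text \<open>A \<open>(k - 1)\<close>-set contributes at most \<open>cross_cut_number H - 1\<close>
  stars, except for the few with at least \<open>cross_cut_number H\<close> centres, which
  contribute at most \<open>L\<close>.\<close>

lemma card_stars:
  assumes V: "finite V" and E: "E \<subseteq> nsets V k" and free: "\<not> contains_copy (V, E) H"
    and r: "real M < r" and P: "P = rich r V E"
  shows "card (stars L V P) \<le> (cross_cut_number H - 1) * (card V choose (k - 1)) + L * (M * 2 ^ L * card V ^ (k - 2))"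
proof -
  define F where "F = {A \<in> nsets V (k - 1). cross_cut_number H \<le> card (centres L V P A)}"
  have PV: "P \<subseteq> nsets V (k - 1)" by (auto simp: P rich_def)
  have fin: "finite (nsets V (k - 1))" using V by (rule finite_imp_finite_nsets)
  have FV: "F \<subseteq> nsets V (k - 1)" by (auto simp: F_def)
  have "card (stars L V P) \<le> (\<Sum>A\<in>nsets V (k - 1). card ((\<lambda>x. insert x A) ` centres L V P A))"
    unfolding stars_def by (rule card_UN_le[OF fin])
  also have "\<dots> \<le> (\<Sum>A\<in>nsets V (k - 1). card (centres L V P A))"
    using card_centres[OF V PV] by (intro sum_mono card_image_le)
  also have "\<dots> \<le> (\<Sum>A\<in>nsets V (k - 1). (cross_cut_number H - 1) + (if A \<in> F then L else 0))"
  proof (rule sum_mono)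
    fix A assume A: "A \<in> nsets V (k - 1)"
    show "card (centres L V P A) \<le> (cross_cut_number H - 1) + (if A \<in> F then L else 0)"
      using card_centres(2)[OF V PV A, of L] A by (auto simp: F_def)
  qed
  also have "\<dots> = (cross_cut_number H - 1) * (card V choose (k - 1)) + L * card F"
    using fin FV by (simp add: sum.distrib sum.If_cases Int_absorb1 mult.commute)
  also have "\<dots> \<le> (cross_cut_number H - 1) * (card V choose (k - 1)) + L * (M * 2 ^ L * card V ^ (k - 2))"
    using card_many_centres[OF assms, of L] by (simp add: F_def)
  finally show ?thesis .
qed

section \<open>Counting the \<open>H\<close>-free edge sets by an encoding\<close>

definition free_edge_sets :: "nat set \<Rightarrow> nat set set set" where
  "free_edge_sets V = {E. E \<subseteq> nsets V k \<and> \<not> contains_copy (V, E) H}"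

lemma forb_eq_card: "forb k n H = card (free_edge_sets {1..n})"
proof -
  have "bij_betw edges {G :: nat hypergraph. verts G = {1..n} \<and> k_graph k G \<and> \<not> contains_copy G H}
      (free_edge_sets {1..n})"
    by (rule bij_betw_byWitness[where f'="\<lambda>E. ({1..n}, E)"]) (auto simp: free_edge_sets_def k_graph_def)
  then show ?thesis unfolding forb_def by (rule bij_betw_same_card)
qed

lemma finite_free_edge_sets: "finite V \<Longrightarrow> finite (free_edge_sets V)"
  by (rule finite_subset[of _ "Pow (nsets V k)"]) (auto simp: free_edge_sets_def finite_imp_finite_nsets)

text \<open>\<open>E\<close> is determined by the hitting data \<open>Y\<close>, the rich family
  \<open>P\<close>, its part inside the stars, and its at most \<open>d\<close> other edges, which
  are chosen among the covered ones. The factors count these in this order.\<close>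

lemma card_free_le:
  assumes V: "finite V" "card V = n" "0 < n" and x: "0 < x" "x \<le> 1"
    and small: "\<And>E. E \<in> free_edge_sets V \<Longrightarrow> card (rich r V E) \<le> p \<and>
      card (stars L V (rich r V E)) \<le> s \<and> card (E - stars L V (rich r V E)) \<le> d"
  shows "real (card (free_edge_sets V)) \<le> (real n ^ M * exp 1) ^ (n ^ (k - 2)) *
    ((real n ^ (k - 1)) ^ p * exp 1) * (2 ^ s * ((1 / x) ^ d * exp (x * (real M * real n ^ (k - 1)))))"
proof -
  define \<Y> where "\<Y> = nsets V (k - 2) \<rightarrow>\<^sub>E {W. W \<subseteq> V \<and> card W \<le> M}"
  define \<P> where "\<P> = {P. P \<subseteq> nsets V (k - 1) \<and> card P \<le> p \<and> card (stars L V P) \<le> s}"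
  define \<C> where "\<C> = (\<lambda>(Y, P). (\<lambda>(S, R). S \<union> R) ` (Pow (stars L V P) \<times> {R. R \<subseteq> covered V Y \<and> card R \<le> d}))"
  have sub: "free_edge_sets V \<subseteq> (\<Union>z\<in>\<Y> \<times> \<P>. \<C> z)"
  proof
    fix E assume E: "E \<in> free_edge_sets V"
    define P where "P = rich r V E"
    have EV: "E \<subseteq> nsets V k" "\<not> contains_copy (V, E) H" using E by (auto simp: free_edge_sets_def)
    obtain Y where Y: "\<forall>B. Y B \<subseteq> V \<and> card (Y B) \<le> M" "E \<subseteq> covered V Y" using light_cover[OF V(1) EV] by blast
    \<comment> \<open>Restricting \<open>Y\<close> to the \<open>(k - 2)\<close>-sets makes it one
      of finitely many data without changing the covered family.\<close>
    define Y' where "Y' = restrict Y (nsets V (k - 2))"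
    have "covered V Y' = covered V Y" by (auto simp: covered_def Y'_def)
    moreover have "Y' \<in> \<Y>" using Y(1) by (auto simp: \<Y>_def Y'_def)
    moreover have "P \<in> \<P>" using small[OF E] by (auto simp: \<P>_def P_def rich_def)
    moreover have "card (E - stars L V P) \<le> d" using small[OF E] by (simp add: P_def)
    moreover have "E = (E \<inter> stars L V P) \<union> (E - stars L V P)" by auto
    ultimately have "E \<in> \<C> (Y', P)" using Y(2) unfolding \<C>_def
      by (simp, intro image_eqI[of _ _ "(E \<inter> stars L V P, E - stars L V P)"]) auto
    then show "E \<in> (\<Union>z\<in>\<Y> \<times> \<P>. \<C> z)" using \<open>Y' \<in> \<Y>\<close> \<open>P \<in> \<P>\<close> by blast
  qed
  have fin\<Y>: "finite \<Y>" unfolding \<Y>_def using V by (intro finite_PiE) (auto simp: finite_imp_finite_nsets)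
  have fin\<P>: "finite \<P>" by (rule finite_subset[of _ "Pow (nsets V (k - 1))"])
      (use V in \<open>auto simp: \<P>_def finite_imp_finite_nsets\<close>)
  have finst: "finite (stars L V P)" for P
    unfolding stars_def using V by (auto simp: finite_imp_finite_nsets centres_def)
  have cov: "finite (covered V Y)" "card (covered V Y) \<le> M * n ^ (k - 1)" if "Y \<in> \<Y>" for Y
  proof -
    have "Y B \<subseteq> V \<and> card (Y B) \<le> M" if "B \<in> nsets V (k - 2)" for B
      using PiE_mem[OF \<open>Y \<in> \<Y>\<close>[unfolded \<Y>_def] that] by simp
    from card_covered[OF V(1) this] show "finite (covered V Y)" "card (covered V Y) \<le> M * n ^ (k - 1)"
      using V(2) by auto
  qed
  define b where "b = 2 ^ s * ((1 / x) ^ d * exp (x * (real M * real n ^ (k - 1))))"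
  have C_bound: "finite (\<C> z) \<and> real (card (\<C> z)) \<le> b" if z: "z \<in> \<Y> \<times> \<P>" for z
  proof -
    obtain Y P where z_eq: "z = (Y, P)" "Y \<in> \<Y>" "P \<in> \<P>" using z by auto
    let ?S = "Pow (stars L V P)" and ?R = "{R. R \<subseteq> covered V Y \<and> card R \<le> d}"
    have fin: "finite ?S" "finite ?R" using finst cov(1)[OF z_eq(2)] by auto
    have "card (\<C> z) \<le> card (?S \<times> ?R)"
      unfolding \<C>_def z_eq prod.case using fin by (intro card_image_le finite_cartesian_product)
    then have "real (card (\<C> z)) \<le> real (card ?S) * real (card ?R)"
      by (simp only: card_cartesian_product of_nat_mult[symmetric] of_nat_le_iff)
    also have "\<dots> \<le> b"
      unfolding b_def
    proof (intro mult_mono)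
      show "real (card ?S) \<le> 2 ^ s" using z_eq(3) finst by (simp add: card_Pow \<P>_def)
      have "real (card ?R) \<le> (1 / x) ^ d * exp (x * real (card (covered V Y)))"
        by (rule card_small_subsets[OF cov(1)[OF z_eq(2)] x])
      also have "\<dots> \<le> (1 / x) ^ d * exp (x * (real M * real n ^ (k - 1)))"
      proof -
        have "real (card (covered V Y)) \<le> real (M * n ^ (k - 1))" using cov(2)[OF z_eq(2)] by (simp only: of_nat_le_iff)
        then show ?thesis using x by (simp add: mult_left_mono)
      qed
      finally show "real (card ?R) \<le> (1 / x) ^ d * exp (x * (real M * real n ^ (k - 1)))" .
    qed auto
    finally show ?thesis using fin by (simp add: \<C>_def z_eq)
  qed
  have b0: "0 \<le> b" using x by (simp add: b_def)
  have "card (free_edge_sets V) \<le> card (\<Union>z\<in>\<Y> \<times> \<P>. \<C> z)"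
    using sub C_bound fin\<Y> fin\<P> by (intro card_mono) auto
  also have "\<dots> \<le> (\<Sum>z\<in>\<Y> \<times> \<P>. card (\<C> z))" using fin\<Y> fin\<P> by (intro card_UN_le) simp
  finally have "real (card (free_edge_sets V)) \<le> (\<Sum>z\<in>\<Y> \<times> \<P>. real (card (\<C> z)))"
    by (simp only: of_nat_sum[symmetric] of_nat_le_iff)
  also have "\<dots> \<le> (\<Sum>z\<in>\<Y> \<times> \<P>. b)" using C_bound by (intro sum_mono) simp
  also have "\<dots> = real (card \<Y>) * real (card \<P>) * b" by (simp add: card_cartesian_product)
  also have "\<dots> \<le> (real n ^ M * exp 1) ^ (n ^ (k - 2)) * ((real n ^ (k - 1)) ^ p * exp 1) * b"
  proof (intro mult_right_mono mult_mono b0)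
    \<comment> \<open>Weight \<open>1 / n\<close> bounds the number of sets of at most
      \<open>M\<close> vertices by \<open>n ^ M * exp 1\<close>; below, weight \<open>1 / N\<close>
      does the same for families of at most \<open>p\<close> sets.\<close>
    have n1: "1 / real n > 0" "1 / real n \<le> 1" using V(3) by auto
    have "real (card {W. W \<subseteq> V \<and> card W \<le> M}) \<le> (1 / (1 / real n)) ^ M * exp (1 / real n * real (card V))"
      by (rule card_small_subsets[OF V(1) n1])
    then have W: "real (card {W. W \<subseteq> V \<and> card W \<le> M}) \<le> real n ^ M * exp 1" using V by simp
    have ge1: "1 \<le> real n ^ M * exp 1"
    proof -
      have "1 * 1 \<le> real n ^ M * exp (1::real)" using V(3) by (intro mult_mono one_le_power) auto
      then show ?thesis by simp
    qed
    have "card \<Y> = card {W. W \<subseteq> V \<and> card W \<le> M} ^ card (nsets V (k - 2))"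
      unfolding \<Y>_def using V by (subst card_PiE) (auto simp: finite_imp_finite_nsets)
    then have "real (card \<Y>) = real (card {W. W \<subseteq> V \<and> card W \<le> M}) ^ card (nsets V (k - 2))" by simp
    also have "\<dots> \<le> (real n ^ M * exp 1) ^ card (nsets V (k - 2))" using W by (intro power_mono) auto
    also have "\<dots> \<le> (real n ^ M * exp 1) ^ (n ^ (k - 2))"
      using ge1 card_nsets_le_power[OF V(1), of "k - 2"] V(2) by (intro power_increasing) auto
    finally show "real (card \<Y>) \<le> (real n ^ M * exp 1) ^ (n ^ (k - 2))" .
    define N where "N = real n ^ (k - 1)"
    have N1: "1 \<le> N" unfolding N_def using V(3) by (intro one_le_power) auto
    have "card \<P> \<le> card {P. P \<subseteq> nsets V (k - 1) \<and> card P \<le> p}"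
      using V by (intro card_mono) (auto simp: \<P>_def finite_imp_finite_nsets)
    then have "real (card \<P>) \<le> real (card {P. P \<subseteq> nsets V (k - 1) \<and> card P \<le> p})" by simp
    also have "\<dots> \<le> (1 / (1 / N)) ^ p * exp (1 / N * real (card (nsets V (k - 1))))"
      using N1 V by (intro card_small_subsets finite_imp_finite_nsets) auto
    also have "\<dots> \<le> N ^ p * exp 1"
    proof -
      have "card (nsets V (k - 1)) \<le> n ^ (k - 1)" using card_nsets_le_power[OF V(1), of "k - 1"] V(2) by simp
      then have "real (card (nsets V (k - 1))) \<le> real (n ^ (k - 1))" by (simp only: of_nat_le_iff)
      then have "real (card (nsets V (k - 1))) \<le> N" by (simp add: N_def)
      then have "1 / N * real (card (nsets V (k - 1))) \<le> 1" using N1 by (simp add: field_simps)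
      then have "exp (1 / N * real (card (nsets V (k - 1)))) \<le> exp (1::real)" by (simp only: exp_le_cancel_iff)
      moreover have "(1 / (1 / N)) ^ p = N ^ p" by simp
      ultimately show ?thesis using N1 by (simp only:) (intro mult_left_mono, auto)
    qed
    finally show "real (card \<P>) \<le> (real n ^ (k - 1)) ^ p * exp 1" by (simp add: N_def)
  qed (use V in auto)
  finally show ?thesis by (simp add: b_def)
qed

section \<open>The lower bound\<close>

text \<open>All subsets of \<open>\<G>\<close>, the edges meeting a fixed \<open>T\<close> in one
  vertex, are \<open>H\<close>-free; the exponent counts such edges as pairs of a vertex of
  \<open>T\<close> and a \<open>(k - 1)\<close>-set off \<open>T\<close>.\<close>

lemma forb_ge:
  assumes "cross_cut_number H \<le> n"
  shows "2 ^ ((cross_cut_number H - 1) * ((n - (cross_cut_number H - 1)) choose (k - 1))) \<le> forb k n H"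
proof -
  define q where "q = cross_cut_number H - 1"
  define T where "T = {1..q}"
  define V where "V = {1..n}"
  define \<G> where "\<G> = {e \<in> nsets V k. card (e \<inter> T) = 1}"
  have TV: "T \<subseteq> V" "card T = q" "card V = n" "finite V" "finite T" using assms by (auto simp: T_def V_def q_def)
  have fin\<G>: "finite \<G>" using TV by (auto simp: \<G>_def finite_imp_finite_nsets)
  have "Pow \<G> \<subseteq> free_edge_sets V"
  proof
    fix E assume E: "E \<in> Pow \<G>"
    have "\<not> contains_copy (V, E) H"
    proof
      assume "contains_copy (V, E) H"
      then obtain f where f: "inj_on f (verts H)" "\<forall>e\<in>edges H. f ` e \<in> E" by (auto simp: contains_copy_def)
      \<comment> \<open>The vertices mapped into \<open>T\<close> would form a cross-cut with at
        most \<open>q\<close> elements, fewer than the minimum.\<close>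
      define S where "S = {v \<in> verts H. f v \<in> T}"
      have "card (e \<inter> S) = 1" if e: "e \<in> edges H" for e
      proof -
        have eV: "e \<subseteq> verts H" using verts_eq e by auto
        have "card (f ` e \<inter> T) = 1" using f(2) e E by (auto simp: \<G>_def)
        moreover have "f ` (e \<inter> S) = f ` e \<inter> T" using eV by (auto simp: S_def)
        moreover have "card (f ` (e \<inter> S)) = card (e \<inter> S)"
          using f(1) eV by (intro card_image) (auto simp: inj_on_def)
        ultimately show ?thesis by simp
      qed
      then have "cross_cut H S" by (auto simp: cross_cut_def S_def)
      moreover have finS: "finite S" using finite_verts by (auto simp: S_def)
      ultimately have "cross_cut_number H \<le> card S" by (rule cross_cut_number_le)
      also have "card S \<le> card T"
        using f(1) TV by (intro card_inj_on_le[of f]) (auto simp: S_def inj_on_def)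
      finally show False using cross_cut_number_pos TV(2) by (simp add: q_def)
    qed
    then show "E \<in> free_edge_sets V" using E by (auto simp: free_edge_sets_def \<G>_def)
  qed
  then have "card (Pow \<G>) \<le> card (free_edge_sets V)"
    using finite_free_edge_sets[OF TV(4)] by (intro card_mono)
  then have le: "2 ^ card \<G> \<le> forb k n H" using fin\<G> by (simp add: card_Pow forb_eq_card V_def)
  have "q * ((n - q) choose (k - 1)) = card (T \<times> nsets (V - T) (k - 1))"
    using TV by (simp add: card_cartesian_product card_Diff_subset)
  also have "\<dots> \<le> card \<G>"
  proof (rule card_inj_on_le[where f="\<lambda>(t, A). insert t A"])
    have dec: "insert t A \<inter> T = {t} \<and> insert t A - T = A" if "t \<in> T" "A \<in> nsets (V - T) (k - 1)" for t A
      using that by (auto simp: nsets_def)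
    show "inj_on (\<lambda>(t, A). insert t A) (T \<times> nsets (V - T) (k - 1))"
    proof (rule inj_onI)
      fix y z assume a: "y \<in> T \<times> nsets (V - T) (k - 1)" "z \<in> T \<times> nsets (V - T) (k - 1)"
        "(case y of (t, A) \<Rightarrow> insert t A) = (case z of (t, A) \<Rightarrow> insert t A)"
      obtain t A t' A' where yz: "y = (t, A)" "z = (t', A')" by (cases y, cases z)
      then have "insert t A = insert t' A'" using a by simp
      then show "y = z" using dec[of t A] dec[of t' A'] a yz by auto
    qed
    show "(\<lambda>(t, A). insert t A) ` (T \<times> nsets (V - T) (k - 1)) \<subseteq> \<G>"
    proof clarify
      fix t A assume tA: "t \<in> T" "A \<in> nsets (V - T) (k - 1)"
      have A: "finite A" "card A = k - 1" "A \<subseteq> V" "t \<notin> A" using tA by (auto simp: nsets_def)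
      then have "insert t A \<in> nsets V k" using tA TV k_ge by (auto simp: nsets_def)
      then show "insert t A \<in> \<G>" using dec[OF tA] by (simp add: \<G>_def)
    qed
    show "finite \<G>" by (rule fin\<G>)
  qed
  finally have "2 ^ (q * ((n - q) choose (k - 1))) \<le> (2::nat) ^ card \<G>" by (intro power_increasing) auto
  then show ?thesis using le unfolding q_def by (rule le_trans)
qed

section \<open>The upper bound on the logarithm\<close>

text \<open>Apart from the main term, each contribution to the logarithm of the bound in
  \<open>card_free_le\<close> is either of lower order or a small multiple of
  \<open>n ^ (k - 1)\<close>. The constants are chosen in the order \<open>x\<close>,
  \<open>\<delta>\<close>, \<open>a\<close>, \<open>c\<close>, \<open>L\<close>, each from the
  earlier ones.\<close>

lemma ln_forb_le:
  assumes \<eta>: "0 < \<eta>"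
  shows "\<forall>\<^sub>F n in sequentially. ln (real (forb k n H)) \<le>
    real (cross_cut_number H - 1) * real (n choose (k - 1)) * ln 2 + \<eta> * real n ^ (k - 1)"
proof -
  have M1: "1 \<le> real M"
  proof -
    obtain e where "e \<in> edges H" using edges_nonempty by auto
    then have "k \<le> M" unfolding M_def using edge_card[of e] card_mono[OF finite_verts, of e] verts_eq by auto
    then show ?thesis using k_ge by simp
  qed
  have k4: "4 \<le> real k" using k_ge by simp
  \<comment> \<open>\<open>x\<close> makes the exponential factor cost a quarter of
    \<open>\<eta>\<close>, and \<open>\<delta>\<close> below makes \<open>(1 / x) ^ d\<close> cost
    another quarter; the summand 1 in the denominator of \<open>\<delta>\<close> covers
    \<open>x = 1\<close>, where the logarithm vanishes.\<close>
  define x where "x = min 1 (\<eta> / (4 * real M))"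
  have x: "0 < x" "x \<le> 1" using \<eta> M1 by (auto simp: x_def)
  have "x \<le> \<eta> / (4 * real M)" by (simp add: x_def)
  then have xM: "x * real M \<le> \<eta> / 4" using M1 by (simp add: field_simps)
  have lx: "0 \<le> ln (1 / x)" using x by (intro ln_ge_zero) simp
  define \<delta> where "\<delta> = \<eta> / (4 * (1 + ln (1 / x)))"
  have \<delta>: "0 < \<delta>" using \<eta> lx by (simp add: \<delta>_def)
  have "\<delta> * (1 + ln (1 / x)) = \<eta> / 4" using lx by (simp add: \<delta>_def field_simps)
  then have \<delta>lx: "\<delta> * ln (1 / x) \<le> \<eta> / 4" using \<delta> by (simp add: algebra_simps)
  \<comment> \<open>With the threshold \<open>r = a * n\<close>, the middle term of
    \<open>card_outside_stars\<close> is exactly a quarter of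
    \<open>\<delta> * n ^ (k - 1)\<close>.\<close>
  define a where "a = \<delta> / (8 * real k * real M)"
  have a: "0 < a" using \<delta> k4 M1 by (simp add: a_def)
  \<comment> \<open>\<open>c * n ^ (k - 2)\<close> bounds the number of rich sets, by double
    counting against the covered edges.\<close>
  define c where "c = real k * real M / a"
  have c: "0 < c" using a k4 M1 by (simp add: c_def)
  \<comment> \<open>\<open>t * n ^ (k - 2)\<close> bounds the first term of
    \<open>card_outside_stars\<close>. It also bounds \<open>card C * k ^ k * M * L\<close>, so a
    large \<open>L\<close> makes the crowded term small; the summand 1 in \<open>L\<close> keeps it
    positive for the division by \<open>L\<close>.\<close>
  define t where "t = real k * real (k ^ k) * real M * c"
  define L where "L = nat \<lceil>8 * t / \<delta>\<rceil> + 1"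
  have t: "0 \<le> t" using c by (simp add: t_def)
  have "8 * t / \<delta> \<le> real L" unfolding L_def by linarith
  then have L: "8 * t \<le> \<delta> * real L" "1 \<le> real L" using \<delta> by (auto simp: field_simps L_def)
  \<comment> \<open>\<open>c1\<close> and \<open>c2\<close> collect the coefficients of
    \<open>n ^ (k - 2) * ln n\<close> and \<open>n ^ (k - 2)\<close>, which use up the remaining
    half of \<open>\<eta>\<close>; the 2 in \<open>c2\<close> pays for the two factors
    \<open>exp 1\<close>.\<close>
  define c1 where "c1 = real M + c * real (k - 1)"
  define c2 where "c2 = 2 + real L * (real M * 2 ^ L) * ln 2"
  have "(\<lambda>n. c1 * (ln (real n) / real n) + c2 * (1 / real n)) \<longlonglongrightarrow> c1 * 0 + c2 * 0"
    by (intro tendsto_add tendsto_mult tendsto_const lim_1_over_n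
        filterlim_compose[OF ln_x_over_x_tendsto_0 filterlim_real_sequentially])
  then have "\<forall>\<^sub>F n in sequentially. c1 * (ln (real n) / real n) + c2 * (1 / real n) < \<eta> / 2"
    using \<eta> by (intro order_tendstoD(2)) auto
  moreover have "\<forall>\<^sub>F n in sequentially. real M / a < real n"
    using filterlim_real_sequentially by (simp add: filterlim_at_top_dense)
  moreover have "\<forall>\<^sub>F n in sequentially. 4 * t / \<delta> < real n"
    using filterlim_real_sequentially by (simp add: filterlim_at_top_dense)
  moreover have "\<forall>\<^sub>F n in sequentially. (0::nat) < n" by (rule eventually_gt_at_top)
  ultimately show ?thesis
  proof eventually_elim
    case (elim n)
    define m where "m = real n ^ (k - 2)"
    have n1: "1 \<le> real n" "0 < n" using elim(4) by auto
    have m1: "1 \<le> m" unfolding m_def using n1 by (intro one_le_power)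
    have "k - 1 = Suc (k - 2)" using k_ge by simp
    then have mn: "real n ^ (k - 1) = m * real n" by (simp add: m_def)
    have small1: "c1 * ln (real n) + c2 \<le> \<eta> / 2 * real n" using elim(1) n1 by (simp add: field_simps)
    define r where "r = a * real n"
    have rM: "real M < r" using elim(2) a by (simp add: r_def field_simps)
    have small3: "4 * t \<le> \<delta> * real n" using elim(3) \<delta> by (simp add: field_simps)
    define V where "V = {1..n}"
    have V: "finite V" "card V = n" by (auto simp: V_def)
    \<comment> \<open>\<open>p\<close> and \<open>d\<close> serve as natural exponents, so the real
      bounds are rounded down.\<close>
    define p where "p = nat \<lfloor>c * m\<rfloor>"
    define d where "d = nat \<lfloor>\<delta> * (m * real n)\<rfloor>"
    define s where "s = (cross_cut_number H - 1) * (n choose (k - 1)) + L * (M * 2 ^ L * n ^ (k - 2))"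
    have "card (rich r V E) \<le> p \<and> card (stars L V (rich r V E)) \<le> s \<and> card (E - stars L V (rich r V E)) \<le> d"
      if "E \<in> free_edge_sets V" for E
    proof -
      have E: "E \<subseteq> nsets V k" "\<not> contains_copy (V, E) H" using that by (auto simp: free_edge_sets_def)
      define P where "P = rich r V E"
      define C where "C = crowded L V P"
      obtain Y where Y: "\<forall>B. Y B \<subseteq> V \<and> card (Y B) \<le> M" "E \<subseteq> covered V Y" using light_cover[OF V(1) E] by blast
      have "card E \<le> card (covered V Y)" using Y card_covered(1)[OF V(1), of Y] by (intro card_mono) auto
      also have "\<dots> \<le> M * n ^ (k - 1)" using card_covered(2)[OF V(1), of Y] Y(1) V(2) by simp
      finally have "real (card E) \<le> real (M * n ^ (k - 1))" by (simp only: of_nat_le_iff)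
      then have Ecard: "real (card E) \<le> real M * (m * real n)" using mn by simp
      have "real (card P) * (a * real n) \<le> real k * real (card E)"
        using card_rich[OF V(1) E(1), of r] by (simp add: P_def r_def)
      also have "\<dots> \<le> real k * (real M * (m * real n))" using Ecard by (intro mult_left_mono) auto
      finally have "(real (card P) * a) * real n \<le> (real k * real M * m) * real n" by (simp add: mult_ac)
      then have "real (card P) * a \<le> real k * real M * m" using n1 by simp
      then have Pc: "real (card P) \<le> c * m" using a by (simp add: c_def field_simps)
      have PV: "P \<subseteq> nsets V (k - 1)" by (auto simp: P_def rich_def)
      have "real (card C) * real L \<le> real k * real (card P)"
        using card_crowded[OF V(1) PV, of L] by (simp add: C_def)
      also have "\<dots> \<le> real k * (c * m)" using Pc by (intro mult_left_mono) auto
      finally have CL: "real (card C) * real L \<le> real k * (c * m)" .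
      have "real (card (E - stars L V P)) \<le> real (k * (card P * k ^ k)) * real M
        + real (k * card V ^ (k - 2)) * (2 * real M * r) + real (card C * k ^ k) * (2 * real M * real (card V))"
        by (rule card_outside_stars[OF V(1) E _ P_def C_def]) (use rM in simp)
      also have "real (k * (card P * k ^ k)) * real M \<le> \<delta> / 4 * (m * real n)"
      proof -
        have "real (k * (card P * k ^ k)) * real M = real k * real (k ^ k) * real M * real (card P)" by simp
        also have "\<dots> \<le> real k * real (k ^ k) * real M * (c * m)" using Pc by (intro mult_left_mono) auto
        also have "\<dots> = t * m" by (simp add: t_def)
        also have "\<dots> \<le> (\<delta> / 4 * real n) * m" using small3 m1 by (intro mult_right_mono) auto
        finally show ?thesis by (simp add: mult_ac)
      qed
      also have "real (k * card V ^ (k - 2)) * (2 * real M * r) = \<delta> / 4 * (m * real n)"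
        using V(2) k4 M1 by (simp add: r_def a_def m_def field_simps)
      also have "real (card C * k ^ k) * (2 * real M * real (card V)) \<le> \<delta> / 4 * (m * real n)"
      proof -
        have "real (card C) * real (k ^ k) * real M * real L = (real (card C) * real L) * (real (k ^ k) * real M)"
          by simp
        also have "\<dots> \<le> (real k * (c * m)) * (real (k ^ k) * real M)" using CL by (intro mult_right_mono) auto
        also have "\<dots> = t * m" by (simp add: t_def)
        also have "\<dots> \<le> (\<delta> * real L / 8) * m" using L m1 by (intro mult_right_mono) auto
        finally have "(real (card C) * real (k ^ k) * real M) * real L \<le> (\<delta> / 8 * m) * real L" by (simp add: mult_ac)
        then have "real (card C) * real (k ^ k) * real M \<le> \<delta> / 8 * m" using L(2) by simp
        then have "(real (card C) * real (k ^ k) * real M) * (2 * real n) \<le> (\<delta> / 8 * m) * (2 * real n)"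
          by (intro mult_right_mono) auto
        then show ?thesis using V(2) by (simp add: mult_ac)
      qed
      finally have "real (card (E - stars L V P)) \<le> 3 * (\<delta> / 4 * (m * real n))" by simp
      also have "\<dots> \<le> \<delta> * (m * real n)"
      proof -
        have "0 \<le> \<delta> * (m * real n)" using \<delta> m1 n1 by simp
        then show ?thesis by simp
      qed
      finally have "card (E - stars L V P) \<le> d" unfolding d_def by (simp add: le_nat_floor)
      moreover have "card P \<le> p" unfolding p_def using Pc by (simp add: le_nat_floor)
      moreover have "card (stars L V P) \<le> s"
        using card_stars[OF V(1) E rM P_def, of L] V(2) by (simp add: s_def)
      ultimately show ?thesis by (simp add: P_def)
    qed
    from card_free_le[OF V n1(2) x this]
    have fl: "real (forb k n H) \<le> (real n ^ M * exp 1) ^ (n ^ (k - 2)) *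
      ((real n ^ (k - 1)) ^ p * exp 1) * (2 ^ s * ((1 / x) ^ d * exp (x * (real M * real n ^ (k - 1)))))"
      (is "_ \<le> ?rhs") by (simp only: forb_eq_card V_def)
    have pd: "real p \<le> c * m" "real d \<le> \<delta> * (m * real n)" using c m1 \<delta> n1 by (auto simp: p_def d_def)
    have pos: "0 < real n ^ M * exp (1::real)" "0 < real n ^ (k - 1)" "0 < 1 / x" using n1 x by auto
    have lnrhs: "ln ?rhs = m * (real M * ln (real n) + 1) + (real p * (real (k - 1) * ln (real n)) + 1)
      + (real s * ln 2 + (real d * ln (1 / x) + x * (real M * (m * real n))))"
    proof -
      have 1: "ln (real n ^ M * exp 1) = real M * ln (real n) + 1" using n1 by (simp add: ln_mult ln_realpow)
      have 2: "ln ((real n ^ (k - 1)) ^ p) = real p * (real (k - 1) * ln (real n))" by (simp only: ln_realpow)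
      have 3: "ln ((real n ^ M * exp 1) ^ (n ^ (k - 2))) = m * (real M * ln (real n) + 1)"
        unfolding ln_realpow 1 by (simp add: m_def)
      have 4: "ln ((1 / x) ^ d) = real d * ln (1 / x)" by (rule ln_realpow)
      have 5: "ln ((2::real) ^ s) = real s * ln 2" by (rule ln_realpow)
      have p1: "0 < (real n ^ M * exp (1::real)) ^ (n ^ (k - 2))" "0 < (real n ^ (k - 1)) ^ p" "0 < (1 / x) ^ d"
        using pos by (auto intro!: zero_less_power)
      define A1 A2 A3 where "A1 = (real n ^ M * exp (1::real)) ^ (n ^ (k - 2))" and "A2 = (real n ^ (k - 1)) ^ p" and "A3 = (1 / x) ^ d"
      have "ln ?rhs = ln A1 + (ln A2 + 1) + (ln (2 ^ s) + (ln A3 + x * (real M * real n ^ (k - 1))))"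
        unfolding A1_def[symmetric] A2_def[symmetric] A3_def[symmetric]
        using p1[folded A1_def A2_def A3_def] by (simp add: ln_mult)
      moreover have "ln A1 = m * (real M * ln (real n) + 1)" using 3 by (simp only: A1_def)
      moreover have "ln A2 = real p * (real (k - 1) * ln (real n))" using 2 by (simp only: A2_def)
      moreover have "ln A3 = real d * ln (1 / x)" using 4 by (simp only: A3_def)
      ultimately show ?thesis using 5 by (simp only: mn)
    qed
    have "ln (real (forb k n H)) \<le> ln ?rhs"
    proof (cases "forb k n H = 0")
      \<comment> \<open>Here \<open>ln 0 = 0\<close>, so the logarithm on the right must be shown
        nonnegative.\<close>
      case True
      have "0 \<le> ln ?rhs" unfolding lnrhs using lx n1 m1 x by (intro add_nonneg_nonneg mult_nonneg_nonneg) auto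
      then show ?thesis unfolding True by simp
    next
      case False
      then show ?thesis using fl by (intro ln_mono) auto
    qed
    also have "\<dots> = m * (real M * ln (real n)) + m + real p * (real (k - 1) * ln (real n)) + 1
      + real s * ln 2 + real d * ln (1 / x) + (x * real M) * (m * real n)"
      unfolding lnrhs by (simp add: algebra_simps)
    also have "\<dots> \<le> m * (real M * ln (real n)) + m + (c * m) * (real (k - 1) * ln (real n)) + m
      + real s * ln 2 + \<eta> / 4 * (m * real n) + \<eta> / 4 * (m * real n)"
    proof -
      have "real p * (real (k - 1) * ln (real n)) \<le> (c * m) * (real (k - 1) * ln (real n))"
        using pd n1 by (intro mult_right_mono) auto
      moreover have "real d * ln (1 / x) \<le> \<eta> / 4 * (m * real n)"
      proof -
        have "real d * ln (1 / x) \<le> \<delta> * (m * real n) * ln (1 / x)" using pd lx by (intro mult_right_mono) auto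
        also have "\<dots> = (\<delta> * ln (1 / x)) * (m * real n)" by simp
        also have "\<dots> \<le> \<eta> / 4 * (m * real n)" using \<delta>lx m1 n1 by (intro mult_right_mono) auto
        finally show ?thesis .
      qed
      moreover have "(x * real M) * (m * real n) \<le> \<eta> / 4 * (m * real n)" using xM m1 n1 by (intro mult_right_mono) auto
      ultimately show ?thesis using m1 by linarith
    qed
    also have "\<dots> = real (cross_cut_number H - 1) * real (n choose (k - 1)) * ln 2 + m * (c1 * ln (real n) + c2)
      + \<eta> / 2 * (m * real n)"
    proof -
      have "real s = real (cross_cut_number H - 1) * real (n choose (k - 1)) + real L * (real M * 2 ^ L * m)"
        by (simp add: s_def m_def)
      then show ?thesis by (simp add: c1_def c2_def algebra_simps)
    qed
    also have "\<dots> \<le> real (cross_cut_number H - 1) * real (n choose (k - 1)) * ln 2 + m * (\<eta> / 2 * real n) + \<eta> / 2 * (m * real n)"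
      using small1 m1 by (intro add_mono order_refl mult_left_mono) auto
    finally show ?case unfolding mn by (simp add: algebra_simps)
  qed
qed

end

section \<open>From the bounds on the logarithm to the error term\<close>

theorem mainTheorem2:
  fixes k :: nat and H :: "'a hypergraph"
  assumes "k \<ge> 4" and "k_tree k H" and "two_contractible H"
  shows "\<exists>\<epsilon> :: nat \<Rightarrow> real. \<epsilon> \<longlonglongrightarrow> 0 \<and>
    (\<forall>\<^sub>F n in sequentially.
      real (forb k n H) =
        2 powr ((real (cross_cut_number H) - 1 + \<epsilon> n) * real (n choose (k - 1))))"
proof -
  interpret contractible_tree k H by unfold_locales (use assms in auto)
  define q where "q = cross_cut_number H - 1"
  have q: "real (cross_cut_number H) - 1 = real q" using cross_cut_number_pos by (simp add: q_def)
  \<comment> \<open>From \<open>(n / (k - 1)) ^ (k - 1) \<le> n choose (k - 1)\<close>; this factor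
    converts errors in \<open>n ^ (k - 1)\<close> into multiples of the binomial
    coefficient.\<close>
  define \<kappa> where "\<kappa> = real (k - 1) ^ (k - 1)"
  have \<kappa>: "0 < \<kappa>" using assms(1) by (simp add: \<kappa>_def)
  \<comment> \<open>The required equation solved for the error; it holds once
    \<open>forb k n H\<close> and the binomial coefficient are positive, so that convergence is the
    main task.\<close>
  define \<epsilon> where "\<epsilon> n = log 2 (real (forb k n H)) / real (n choose (k - 1)) - real q" for n
  have choose_ge: "real n ^ (k - 1) \<le> \<kappa> * real (n choose (k - 1))" if "k \<le> n" for n
    using binomial_ge_n_over_k_pow_k[of "k - 1" n, where 'a=real] that \<kappa>
    by (simp add: \<kappa>_def power_divide field_simps)
  have choose_pos: "0 < real (n choose (k - 1))" if "k \<le> n" for n using that by simp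
  \<comment> \<open>Positivity of \<open>forb k n H\<close> is included because
    \<open>2 powr log 2 y = y\<close> needs \<open>y > 0\<close>.\<close>
  have lower: "real q * (real (n choose (k - 1)) - real q * real n ^ (k - 2)) \<le> log 2 (real (forb k n H))
      \<and> 0 < forb k n H" if n: "cross_cut_number H \<le> n" for n
  proof -
    have "2 ^ (q * ((n - q) choose (k - 1))) \<le> forb k n H" using forb_ge[OF n] by (simp only: q_def)
    then have ge: "2 ^ (q * ((n - q) choose (k - 1))) \<le> real (forb k n H)"
      by (metis of_nat_le_iff of_nat_numeral of_nat_power)
    have pos: "0 < forb k n H"
      using \<open>2 ^ (q * ((n - q) choose (k - 1))) \<le> forb k n H\<close> by (meson less_le_trans zero_less_numeral zero_less_power)
    have "log 2 (2 ^ (q * ((n - q) choose (k - 1)))) \<le> log 2 (real (forb k n H))"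
      using ge by (intro log_mono) auto
    then have lg: "real q * real ((n - q) choose (k - 1)) \<le> log 2 (real (forb k n H))" by (simp add: log_nat_power)
    have "k - 1 = Suc (k - 2)" using assms(1) by simp
    then have "n choose (k - 1) \<le> ((n - q) choose (k - 1)) + q * n ^ (k - 2)"
      using choose_le_shifted[of q n "k - 2"] n by (simp add: q_def)
    then have "real (n choose (k - 1)) \<le> real (((n - q) choose (k - 1)) + q * n ^ (k - 2))" by (simp only: of_nat_le_iff)
    then have "real (n choose (k - 1)) - real q * real n ^ (k - 2) \<le> real ((n - q) choose (k - 1))" by simp
    then have "real q * (real (n choose (k - 1)) - real q * real n ^ (k - 2)) \<le> real q * real ((n - q) choose (k - 1))"
      by (intro mult_left_mono) auto
    then show ?thesis using lg pos by linarith
  qed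
  have "\<epsilon> \<longlonglongrightarrow> 0"
  proof (rule LIMSEQ_I)
    fix e :: real assume e: "0 < e"
    \<comment> \<open>After the factor \<open>\<kappa>\<close> and the change to base 2, the error
      \<open>\<eta> * n ^ (k - 1)\<close> is at most \<open>e / 2\<close> times the binomial
      coefficient.\<close>
    define \<eta> where "\<eta> = e * ln 2 / (2 * \<kappa>)"
    have \<eta>: "0 < \<eta>" using e \<kappa> by (simp add: \<eta>_def)
    \<comment> \<open>Past this bound the loss \<open>q * q * n ^ (k - 2)\<close> in
      \<open>lower\<close> is at most \<open>e / 2\<close> times the binomial coefficient.\<close>
    have "\<forall>\<^sub>F n in sequentially. 2 * (real q * real q * \<kappa>) / e < real n"
      using filterlim_real_sequentially by (simp add: filterlim_at_top_dense)
    then have "\<forall>\<^sub>F n in sequentially. norm (\<epsilon> n - 0) < e"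
      using ln_forb_le[OF \<eta>] eventually_ge_at_top[of k] eventually_ge_at_top[of "cross_cut_number H"]
        eventually_gt_at_top[of 0]
    proof eventually_elim
      case (elim n)
      define b where "b = real (n choose (k - 1))"
      have b: "0 < b" using choose_pos[OF elim(3)] by (simp add: b_def)
      define l where "l = log 2 (real (forb k n H))"
      have nk: "real n ^ (k - 1) \<le> \<kappa> * b" using choose_ge[OF elim(3)] by (simp add: b_def)
      have "ln (real (forb k n H)) \<le> real q * b * ln 2 + \<eta> * real n ^ (k - 1)"
        using elim(2) by (simp add: q_def b_def)
      also have "\<dots> \<le> real q * b * ln 2 + \<eta> * (\<kappa> * b)" using nk \<eta> by simp
      also have "\<dots> = (real q * b + e / 2 * b) * ln 2" using \<kappa> by (simp add: \<eta>_def field_simps)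
      finally have up: "l \<le> real q * b + e / 2 * b" by (simp add: l_def log_def field_simps)
      have "real q * real q * real n ^ (k - 2) \<le> e / 2 * b"
      proof -
        have "k - 1 = Suc (k - 2)" using assms(1) by simp
        then have kn: "real n ^ (k - 1) = real n ^ (k - 2) * real n" by simp
        have n0: "0 < real n" using elim(5) by simp
        have "real q * real q * \<kappa> \<le> e / 2 * real n" using elim(1) e by (simp add: field_simps)
        then have "real q * real q * \<kappa> * b \<le> e / 2 * real n * b" using b by (intro mult_right_mono) auto
        moreover have "real q * real q * (real n ^ (k - 2) * real n) \<le> real q * real q * (\<kappa> * b)"
          using nk kn by (intro mult_left_mono) auto
        ultimately have "(real q * real q * real n ^ (k - 2)) * real n \<le> (e / 2 * b) * real n" by (simp add: mult_ac)
        then show ?thesis using n0 by simp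
      qed
      then have "real q * b - e / 2 * b \<le> l" using lower[OF elim(4)] by (simp add: b_def l_def algebra_simps)
      then have "real q - e / 2 \<le> l / b" "l / b \<le> real q + e / 2" using up b by (auto simp: field_simps)
      then have "\<bar>l / b - real q\<bar> \<le> e / 2" by linarith
      then show ?case using e by (simp add: \<epsilon>_def l_def b_def)
    qed
    then show "\<exists>no. \<forall>n\<ge>no. norm (\<epsilon> n - 0) < e" by (simp add: eventually_sequentially)
  qed
  moreover have "\<forall>\<^sub>F n in sequentially. real (forb k n H) =
      2 powr ((real (cross_cut_number H) - 1 + \<epsilon> n) * real (n choose (k - 1)))"
    using eventually_ge_at_top[of k] eventually_ge_at_top[of "cross_cut_number H"]
  proof eventually_elim
    case (elim n)
    have "(real (cross_cut_number H) - 1 + \<epsilon> n) * real (n choose (k - 1)) = log 2 (real (forb k n H))"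
      unfolding q \<epsilon>_def using choose_pos[OF elim(1)] by simp
    then show ?case using lower[OF elim(2)] by simp
  qed
  ultimately show ?thesis by blast
qed

end
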